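(* Let $M_1,M_2$ be matroids of positive rank on disjoint ground sets $S_1,S_2$, let $S'_1\subseteq S_1$, $S'_2\subseteq S_2$, let $T_1,T_2$ be sets such that $T_1,T_2,S_1\cup S_2$ are pairwise disjoint, let $k$ be an integer with $|T_1|=k-r(M_1)-|S'_2|$ and $|T_2|=k-r(M_2)-|S'_1|$, and let $j=|S_1|+|S_2|+|T_1|+|T_2|-k$. Then $$j\ge r(M_1^* )+\eta_{M_1^*}(S_1-S'_1)+r(M_2^* )+\eta_{M_2^*}(S_2-S'_2)$$ if and only if $k\ge r(M_1)+\eta_{M_1}(S'_1)+r(M_2)+\eta_{M_2}(S'_2)$. Moreover, when these inequalities hold, $$\bigl(M_k(M_1,S'_1,T_1;M_2,S'_2,T_2)\bigr)^*=M_j(M_1^*,S_1-S'_1,T_2;M_2^*,S_2-S'_2,T_1).$$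
   Context: All matroids are finite. A cyclic flat is a flat that is a (possibly empty) union of circuits; for a matroid $N$, $\mathcal{Z}'(N)$ denotes its set of nonempty proper cyclic flats, and $\eta_N(Y)=|Y|-r_N(Y)$ is the nullity. A matroid is determined by its cyclic flats and their ranks. Construction $M_k(N_1,A_1,U_1;N_2,A_2,U_2)$: let $N_1,N_2$ be matroids of positive rank on disjoint ground sets $R_1,R_2$ with rank functions $\rho_1,\rho_2$; let $A_1\subseteq R_1$, $A_2\subseteq R_2$; let $k$ be an integer with $k\ge r(N_1)+\eta_{N_1}(A_1)+r(N_2)+\eta_{N_2}(A_2)$; and let $U_1,U_2$ be sets with $|U_1|=k-r(N_1)-|A_2|$, $|U_2|=k-r(N_2)-|A_1|$, such that $U_1,U_2,R_1\cup R_2$ are pairwise disjoint. Let $E=R_1\cup R_2\cup U_1\cup U_2$. Then $M_k(N_1,A_1,U_1;N_2,A_2,U_2)$ is the (existing and unique) matroid on $E$ whose cyclic flats are exactly: $\emptyset$, of rank $0$; $E$, of rank $k$; the sets $F\cup U_1\cup A_2$ for $F\in\mathcal{Z}'(N_1)$, of rank $\rho_1(F)+|U_1|+|A_2|$; and the sets $F\cup U_2\cup A_1$ for $F\in\mathcal{Z}'(N_2)$, of rank $\rho_2(F)+|U_2|+|A_1|$.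
   Formalization: The duality equation is stated whenever M_k exists, which is proved when M_1^*, M_2^* have positive rank; existence can fail for free M_i, e.g. M_1=M_2=U_{1,1}, S'_i=S_i, T_i empty, k=2. *)

theory Defs
  imports Main
begin

text \<open>The independent sets form a set of subsets of the ground set, so that equality of
  \<open>'a matroid\<close> values satisfying the predicate \<open>matroid\<close> is equality of matroids.\<close>

datatype 'a matroid = Matroid (ground: "'a set") (indeps: "'a set set")

definition matroid :: "'a matroid \<Rightarrow> bool" where
  "matroid M \<longleftrightarrow>
     finite (ground M) \<and>
     indeps M \<subseteq> Pow (ground M) \<and>
     {} \<in> indeps M \<and>
     (\<forall>I\<in>indeps M. \<forall>J. J \<subseteq> I \<longrightarrow> J \<in> indeps M) \<and>
     (\<forall>I\<in>indeps M. \<forall>J\<in>indeps M. card I < card J \<longrightarrow>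
        (\<exists>x\<in>J - I. insert x I \<in> indeps M))"

definition rank :: "'a matroid \<Rightarrow> 'a set \<Rightarrow> nat" where
  "rank M X = Max (card ` {I \<in> indeps M. I \<subseteq> X})"

abbreviation total_rank :: "'a matroid \<Rightarrow> nat" where
  "total_rank M \<equiv> rank M (ground M)"

definition nullity :: "'a matroid \<Rightarrow> 'a set \<Rightarrow> int" where
  "nullity M X = int (card X) - int (rank M X)"

definition basis :: "'a matroid \<Rightarrow> 'a set \<Rightarrow> bool" where
  "basis M B \<longleftrightarrow> B \<in> indeps M \<and> (\<forall>I\<in>indeps M. B \<subseteq> I \<longrightarrow> I = B)"

definition circuit :: "'a matroid \<Rightarrow> 'a set \<Rightarrow> bool" where
  "circuit M C \<longleftrightarrow> C \<subseteq> ground M \<and> C \<notin> indeps M \<and> (\<forall>D. D \<subset> C \<longrightarrow> D \<in> indeps M)"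

definition flat :: "'a matroid \<Rightarrow> 'a set \<Rightarrow> bool" where
  "flat M F \<longleftrightarrow> F \<subseteq> ground M \<and> (\<forall>x\<in>ground M - F. rank M F < rank M (insert x F))"

definition cyclic_flat :: "'a matroid \<Rightarrow> 'a set \<Rightarrow> bool" where
  "cyclic_flat M F \<longleftrightarrow> flat M F \<and> (\<exists>\<C>. (\<forall>C\<in>\<C>. circuit M C) \<and> F = \<Union>\<C>)"

definition proper_cyclic_flats :: "'a matroid \<Rightarrow> 'a set set" where
  "proper_cyclic_flats M = {F. cyclic_flat M F \<and> F \<noteq> {} \<and> F \<noteq> ground M}"

text \<open>The bases of the dual are the complements of the bases of \<open>M\<close>.\<close>

definition dual :: "'a matroid \<Rightarrow> 'a matroid" where
  "dual M = Matroid (ground M) {I. \<exists>B. basis M B \<and> I \<subseteq> ground M - B}"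

text \<open>\<open>is_Mk k N1 A1 U1 N2 A2 U2 M\<close> says that \<open>M\<close> is the matroid
  $M_k(N_1,A_1,U_1;N_2,A_2,U_2)$. The numerical and disjointness conditions on the
  data under which the construction is considered are not part of the predicate.\<close>

definition is_Mk ::
  "int \<Rightarrow> 'a matroid \<Rightarrow> 'a set \<Rightarrow> 'a set \<Rightarrow> 'a matroid \<Rightarrow> 'a set \<Rightarrow> 'a set \<Rightarrow> 'a matroid \<Rightarrow> bool" where
  "is_Mk k N1 A1 U1 N2 A2 U2 M \<longleftrightarrow>
     matroid M \<and>
     ground M = ground N1 \<union> ground N2 \<union> U1 \<union> U2 \<and>
     {Z. cyclic_flat M Z} =
       {{}, ground M}
       \<union> {F \<union> U1 \<union> A2 | F. F \<in> proper_cyclic_flats N1}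
       \<union> {F \<union> U2 \<union> A1 | F. F \<in> proper_cyclic_flats N2} \<and>
     rank M {} = 0 \<and>
     int (total_rank M) = k \<and>
     (\<forall>F\<in>proper_cyclic_flats N1. rank M (F \<union> U1 \<union> A2) = rank N1 F + card U1 + card A2) \<and>
     (\<forall>F\<in>proper_cyclic_flats N2. rank M (F \<union> U2 \<union> A1) = rank N2 F + card U2 + card A1)"

text \<open>Meaningful only where a matroid with the prescribed cyclic flats and ranks exists.
  That can fail if \<open>N1\<close> or \<open>N2\<close> is free: for two free matroids, \<open>A1 = ground N1\<close>,
  \<open>A2 = ground N2\<close>, \<open>U1 = U2 = {}\<close> and \<open>k\<close> the size of the whole ground set, the whole
  ground set would be a cyclic flat of nullity 0.\<close>

definition Mk ::
  "int \<Rightarrow> 'a matroid \<Rightarrow> 'a set \<Rightarrow> 'a set \<Rightarrow> 'a matroid \<Rightarrow> 'a set \<Rightarrow> 'a set \<Rightarrow> 'a matroid" where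
  "Mk k N1 A1 U1 N2 A2 U2 = (THE M. is_Mk k N1 A1 U1 N2 A2 U2 M)"

end

theory Submission
  imports Defs
begin

text \<open>A matroid is recovered from its ranked cyclic flats through
  \<open>r X = min {r Z + |X - Z| | Z cyclic flat}\<close>, which gives uniqueness. In terms of the rank
  function, a cyclic flat is a closed set without coloops; by the formula
  \<open>r* X = |X| + r (E - X) - r E\<close> complementation exchanges these two conditions, so the
  cyclic flats of the dual are the complements of the cyclic flats, and the duality statement
  reduces to counting. Existence is the converse of the recovery formula (Sims; Bonin and
  de Mier): if a ranked family of sets satisfies suitable axioms, the same minimum defines the rank
  function of a matroid with that family as its cyclic flats. The lower bound on \<open>k\<close> is
  exactly what the submodularity axiom needs for two sets from different sides.\<close>

section \<open>Rank functions\<close>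

text \<open>Above a flat F of N1 and a flat G of N2, lifted to different sides, the only common
  bounds are E and {}. Their intersection consists of F \<inter> A1 and G \<inter> A2, so
  submodularity asks for k + |F \<inter> A1| + |G \<inter> A2| to be at most the sum of the two
  prescribed ranks. Substituting the sizes of U1 and U2 turns this into k \<ge> r(N1) + r(N2) + (|F
  \<inter> A1| - r(F)) + (|G \<inter> A2| - r(G)), and the brackets are at most the nullities of A1
  and A2. The same bound on k also keeps flats from different sides incomparable. What it cannot
  supply is a positive nullity of E when N1 and N2 are free. Existence is therefore proved for
  matroids whose duals have positive rank, whereas duality is proved for any given matroid that
  realises the data.\<close>

locale rank_function =
  fixes E :: "'a set" and r :: "'a set \<Rightarrow> nat"
  assumes finite_E: "finite E"
    and r_le_card: "X \<subseteq> E \<Longrightarrow> r X \<le> card X"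
    and r_mono: "X \<subseteq> Y \<Longrightarrow> Y \<subseteq> E \<Longrightarrow> r X \<le> r Y"
    and r_submodular: "X \<subseteq> E \<Longrightarrow> Y \<subseteq> E \<Longrightarrow> r (X \<union> Y) + r (X \<inter> Y) \<le> r X + r Y"
begin

definition closed :: "'a set \<Rightarrow> bool" where
  "closed F \<longleftrightarrow> F \<subseteq> E \<and> (\<forall>x\<in>E - F. r F < r (insert x F))"

definition coloop_free :: "'a set \<Rightarrow> bool" where
  "coloop_free F \<longleftrightarrow> F \<subseteq> E \<and> (\<forall>x\<in>F. r (F - {x}) = r F)"

lemma finite_subset_E: "X \<subseteq> E \<Longrightarrow> finite X"
  using finite_E finite_subset by blast

lemma r_empty [simp]: "r {} = 0"
  using r_le_card[of "{}"] by simp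

lemma r_Un_le:
  assumes "X \<subseteq> E" "Y \<subseteq> E" shows "r (X \<union> Y) \<le> r X + card Y"
  using r_submodular[OF assms] r_le_card[OF assms(2)] by linarith

lemma r_diff_le:
  assumes "Y \<subseteq> E" shows "X \<subseteq> Y \<Longrightarrow> r Y \<le> r X + card (Y - X)"
  using r_Un_le[of X "Y - X"] assms by (simp add: Un_absorb1 subset_iff)

text \<open>Diminishing returns: for x outside \<open>Y\<close>, the sets \<open>insert x X\<close>
  and \<open>Y\<close> have union \<open>insert x Y\<close> and intersection \<open>X\<close>, so
  submodularity applies. This is what transfers spanning and absence of coloops to larger
  sets.\<close>

lemma r_span_mono:
  assumes "X \<subseteq> Y" "insert x Y \<subseteq> E" "r (insert x X) = r X"
  shows "r (insert x Y) = r Y"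
proof (cases "x \<in> Y")
  case False
  then have "insert x X \<union> Y = insert x Y" "insert x X \<inter> Y = X"
    using assms(1) by auto
  then have "r (insert x Y) \<le> r Y"
    using r_submodular[of "insert x X" Y] assms by auto
  moreover have "r Y \<le> r (insert x Y)"
    using assms(2) by (intro r_mono) auto
  ultimately show ?thesis by simp
qed (simp add: insert_absorb)

lemma r_coloop_mono:
  assumes "X \<subseteq> Y" "Y \<subseteq> E" "x \<in> X" "r (X - {x}) = r X"
  shows "r (Y - {x}) = r Y"
  using r_span_mono[of "X - {x}" "Y - {x}" x] assms by (simp add: insert_absorb subset_iff)

text \<open>Elements of \<open>A\<close> are added one at a time; \<open>r_span_mono\<close> keeps
  each of them redundant over the enlarged set.\<close>

lemma r_Un_span:
  assumes "X \<subseteq> E" "A \<subseteq> E" "\<And>x. x \<in> A \<Longrightarrow> r (insert x X) = r X"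
  shows "r (X \<union> A) = r X"
proof -
  have "finite A" using assms(2) by (rule finite_subset_E)
  then show ?thesis using assms(2,3)
  proof (induction A)
    case (insert a A)
    have "r (insert a X) = r X" using insert.prems(2) by blast
    moreover have "insert a (X \<union> A) \<subseteq> E" using insert.prems(1) assms(1) by blast
    ultimately have "r (insert a (X \<union> A)) = r (X \<union> A)"
      using r_span_mono[of X "X \<union> A" a] by blast
    moreover have "r (X \<union> A) = r X"
      using insert.prems(1) by (intro insert.IH insert.prems(2)) auto
    ultimately show ?case by simp
  qed simp
qed

section \<open>The matroid defined by a rank function\<close>

definition to_matroid :: "'a matroid" where
  "to_matroid = Matroid E {I. I \<subseteq> E \<and> r I = card I}"

lemma ground_to_matroid [simp]: "ground to_matroid = E"
  by (simp add: to_matroid_def)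

lemma indep_to_matroid: "I \<in> indeps to_matroid \<longleftrightarrow> I \<subseteq> E \<and> r I = card I"
  by (simp add: to_matroid_def)

text \<open>The rank of \<open>insert x I\<close> is pinned between |I| and |I| + 1, so any gain at
  all means independence.\<close>

lemma indep_insert_iff:
  assumes "I \<in> indeps to_matroid" "x \<in> E - I"
  shows "insert x I \<in> indeps to_matroid \<longleftrightarrow> r (insert x I) \<noteq> r I"
proof -
  have I: "I \<subseteq> E" "r I = card I" "finite I"
    using assms by (auto simp: indep_to_matroid finite_subset_E)
  moreover have "r (insert x I) \<le> card (insert x I)" "r I \<le> r (insert x I)"
    using assms(2) I(1) r_le_card[of "insert x I"] r_mono[of I "insert x I"] by blast+
  moreover have "card (insert x I) = Suc (card I)"
    using assms(2) I by simp
  ultimately show ?thesis using assms(2) unfolding indep_to_matroid by auto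
qed

lemma matroid_to_matroid: "matroid to_matroid"
  unfolding matroid_def
proof (intro conjI ballI allI impI)
  show "indeps to_matroid \<subseteq> Pow (ground to_matroid)"
    by (auto simp: indep_to_matroid)
next
  fix I J assume "I \<in> indeps to_matroid" "J \<subseteq> I"
  then have IJ: "I \<subseteq> E" "r I = card I" "J \<subseteq> I" "J \<subseteq> E"
    by (auto simp: indep_to_matroid)
  moreover have "card (I - J) = card I - card J" "card J \<le> card I"
    using IJ by (auto intro: card_Diff_subset card_mono finite_subset_E)
  ultimately show "J \<in> indeps to_matroid"
    using r_diff_le[of I J] r_le_card[of J] by (simp add: indep_to_matroid)
next
  fix I J assume IJ: "I \<in> indeps to_matroid" "J \<in> indeps to_matroid" "card I < card J"
  show "\<exists>x\<in>J - I. insert x I \<in> indeps to_matroid"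
  proof (rule ccontr)
    assume "\<not> ?thesis"
    \<comment> \<open>Without an augmenting element I spans J, which would give |J| = r J \<le> r I
      = |I|.\<close>
    then have "r (insert x I) = r I" if "x \<in> J" for x
      using indep_insert_iff[OF IJ(1), of x] IJ that
      by (cases "x \<in> I") (auto simp: indep_to_matroid insert_absorb)
    then have "r (I \<union> J) = r I"
      using IJ by (intro r_Un_span) (auto simp: indep_to_matroid)
    moreover have "r J \<le> r (I \<union> J)"
      using IJ by (intro r_mono) (auto simp: indep_to_matroid)
    ultimately show False using IJ by (auto simp: indep_to_matroid)
  qed
qed (auto simp: finite_E indep_to_matroid)

lemma rank_to_matroid:
  assumes "X \<subseteq> E" shows "rank to_matroid X = r X"
proof -
  define \<I> where "\<I> = {I \<in> indeps to_matroid. I \<subseteq> X}"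
  have "\<I> \<subseteq> Pow X" by (auto simp: \<I>_def)
  then have fin: "finite \<I>"
    using finite_subset_E[OF assms] by (simp add: finite_subset)
  have "{} \<in> \<I>" by (simp add: \<I>_def indep_to_matroid)
  from finite_has_maximal2[OF fin this]
  obtain I where I: "I \<in> \<I>" "\<forall>J\<in>\<I>. I \<subseteq> J \<longrightarrow> I = J" by blast
  then have IX: "I \<in> indeps to_matroid" "I \<subseteq> X" by (auto simp: \<I>_def)
  \<comment> \<open>Maximality makes I span X, so |I| equals r X instead of merely bounding it from
    below.\<close>
  have "r (insert x I) = r I" if "x \<in> X" for x
  proof (cases "x \<in> I")
    case False
    then have "insert x I \<notin> \<I>" using I(2) by blast
    then have "insert x I \<notin> indeps to_matroid" using IX that by (simp add: \<I>_def)
    then show ?thesis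
      using indep_insert_iff[of I x] IX False that assms by auto
  qed (simp add: insert_absorb)
  then have "r (I \<union> X) = r I"
    using IX assms by (intro r_Un_span) auto
  moreover have "I \<union> X = X" "r I = card I"
    using IX by (auto simp: indep_to_matroid)
  ultimately have rX: "r X = card I" by simp
  moreover have "card J \<le> r X" if "J \<in> \<I>" for J
    using that assms r_mono[of J X] by (auto simp: \<I>_def indep_to_matroid)
  ultimately show ?thesis
    unfolding rank_def \<I>_def[symmetric] using fin I(1) rX by (intro Max_eqI) auto
qed

section \<open>Coloop-free kernels, closures, and bounds for pairs of cyclic flats\<close>

lemma coloop_free_kernel:
  assumes "X \<subseteq> E"
  shows "\<exists>K\<subseteq>X. coloop_free K \<and> r K + card (X - K) = r X"
  using finite_subset_E[OF assms] assms
proof (induction X rule: finite_psubset_induct)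
  case (psubset X)
  show ?case
  proof (cases "coloop_free X")
    case True
    then show ?thesis by (intro exI[of _ X]) simp
  next
    case False
    then obtain x where x: "x \<in> X" "r (X - {x}) \<noteq> r X"
      using psubset.prems by (auto simp: coloop_free_def)
    then obtain K where K: "K \<subseteq> X - {x}" "coloop_free K"
        "r K + card (X - {x} - K) = r (X - {x})"
      using psubset.IH[of "X - {x}"] psubset.prems by blast
    have "X - K = insert x (X - {x} - K)" using x K by auto
    then have "card (X - K) = Suc (card (X - {x} - K))"
      using psubset.hyps by simp
    \<comment> \<open>Deleting the coloop loses at least one unit of rank, and going from K back to
      X gains at most |X - K|; hence the count is exact.\<close>
    moreover have "r (X - {x}) < r X"
      using x psubset.prems r_mono[of "X - {x}" X] by simp
    moreover have "r X \<le> r K + card (X - K)"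
      using r_diff_le[of X K] psubset.prems K by auto
    ultimately have "r K + card (X - K) = r X" using K by linarith
    then show ?thesis using K by blast
  qed
qed

text \<open>Stripping the coloops from a flat leaves a flat. A point outside X spanned by K would be
  spanned by X, and a point of X - K spanned by K would push r X below r K + |X - K|. For the
  intersection of two cyclic flats this gives their meet.\<close>

lemma closed_kernel:
  assumes "closed X"
  shows "\<exists>K\<subseteq>X. closed K \<and> coloop_free K \<and> r K + card (X - K) = r X"
proof -
  obtain K where K: "K \<subseteq> X" "coloop_free K" "r K + card (X - K) = r X"
    using coloop_free_kernel[of X] assms by (auto simp: closed_def)
  have XE: "X \<subseteq> E" using assms by (simp add: closed_def)
  have "r K < r (insert x K)" if x: "x \<in> E - K" for x
  proof (rule ccontr)
    assume "\<not> ?thesis"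
    then have eq: "r (insert x K) = r K"
      using r_mono[of K "insert x K"] x K XE by fastforce
    have "x \<in> X"
    proof (rule ccontr)
      assume "x \<notin> X"
      then have "r X < r (insert x X)" using assms x by (simp add: closed_def)
      moreover have "r (insert x X) = r X"
        using r_span_mono[OF K(1) _ eq] x XE by simp
      ultimately show False by simp
    qed
    then have "card (X - insert x K) < card (X - K)"
      using x finite_subset_E[OF XE] by (intro psubset_card_mono) auto
    moreover have "r X \<le> r (insert x K) + card (X - insert x K)"
      using r_diff_le[of X "insert x K"] \<open>x \<in> X\<close> K XE by auto
    ultimately show False using eq K by linarith
  qed
  then show ?thesis using K XE by (auto simp: closed_def)
qed

text \<open>Closing creates no coloops: a new point x is spanned by X, which stays inside F - {x}.
  For the union of two cyclic flats this gives their join.\<close>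

lemma coloop_free_closure:
  assumes "coloop_free X"
  shows "\<exists>F. X \<subseteq> F \<and> closed F \<and> coloop_free F \<and> r F = r X"
proof -
  define F where "F = {x \<in> E. r (insert x X) = r X}"
  have XE: "X \<subseteq> E" using assms by (simp add: coloop_free_def)
  have XF: "X \<subseteq> F" and FE: "F \<subseteq> E" using XE by (auto simp: F_def insert_absorb)
  have "r (X \<union> F) = r X" using XE by (intro r_Un_span) (auto simp: F_def)
  then have rF: "r F = r X" using XF by (simp add: Un_absorb1)
  have "r F < r (insert x F)" if x: "x \<in> E - F" for x
  proof -
    have "r (insert x X) \<noteq> r X" using x by (simp add: F_def)
    moreover have "r X \<le> r (insert x X)" "r (insert x X) \<le> r (insert x F)"
      using x XF FE XE by (auto intro!: r_mono)
    ultimately show ?thesis using rF by simp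
  qed
  moreover have "r (F - {x}) = r F" if "x \<in> F" for x
  proof (cases "x \<in> X")
    case True
    then show ?thesis
      using r_coloop_mono[OF XF FE] assms by (simp add: coloop_free_def)
  next
    case False
    then have "r X \<le> r (F - {x})" "r (F - {x}) \<le> r F"
      using XF FE by (auto intro!: r_mono)
    then show ?thesis using rF by simp
  qed
  ultimately have "closed F" "coloop_free F"
    using FE by (simp_all add: closed_def coloop_free_def)
  then show ?thesis using XF rF by blast
qed

text \<open>Z is the closure of the coloop-free kernel of X. Passing to the closure keeps the rank
  and can only shrink the part of X left outside, while r Z + |X - Z| bounds r X from above in any
  case. Z need not lie inside X.\<close>

lemma r_attained:
  assumes "X \<subseteq> E"
  shows "\<exists>Z. closed Z \<and> coloop_free Z \<and> r X = r Z + card (X - Z)"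
proof -
  obtain K where K: "K \<subseteq> X" "coloop_free K" "r K + card (X - K) = r X"
    using coloop_free_kernel[OF assms] by blast
  obtain Z where Z: "K \<subseteq> Z" "closed Z" "coloop_free Z" "r Z = r K"
    using coloop_free_closure[OF K(2)] by blast
  have "card (X - Z) \<le> card (X - K)"
    using Z finite_subset_E[OF assms] by (intro card_mono) auto
  moreover have "r X \<le> r (Z \<union> (X - Z))"
    using Z assms by (intro r_mono) (auto simp: closed_def)
  moreover have "r (Z \<union> (X - Z)) \<le> r Z + card (X - Z)"
    using Z assms by (intro r_Un_le) (auto simp: closed_def)
  ultimately have "r X = r Z + card (X - Z)" using K Z by linarith
  then show ?thesis using Z by blast
qed

lemma coloop_free_Un:
  assumes "coloop_free X" "coloop_free Y" shows "coloop_free (X \<union> Y)"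
  unfolding coloop_free_def
proof (intro conjI ballI)
  show E: "X \<union> Y \<subseteq> E" using assms by (auto simp: coloop_free_def)
  fix x assume "x \<in> X \<union> Y"
  then show "r (X \<union> Y - {x}) = r (X \<union> Y)"
    using r_coloop_mono[OF _ E, of X x] r_coloop_mono[OF _ E, of Y x] assms
    by (auto simp: coloop_free_def)
qed

lemma closed_Int:
  assumes "closed X" "closed Y" shows "closed (X \<inter> Y)"
  unfolding closed_def
proof (intro conjI ballI)
  show E: "X \<inter> Y \<subseteq> E" using assms by (auto simp: closed_def)
  fix x assume x: "x \<in> E - X \<inter> Y"
  have "r (insert x (X \<inter> Y)) \<noteq> r (X \<inter> Y)"
  proof
    assume "r (insert x (X \<inter> Y)) = r (X \<inter> Y)"
    then have "r (insert x X) = r X" "r (insert x Y) = r Y"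
      using assms x by (auto intro!: r_span_mono[of "X \<inter> Y"] simp: closed_def)
    moreover have "x \<in> E - X \<or> x \<in> E - Y" using x by auto
    ultimately show False using assms unfolding closed_def by (metis less_irrefl)
  qed
  moreover have "r (X \<inter> Y) \<le> r (insert x (X \<inter> Y))"
    using E x by (intro r_mono) auto
  ultimately show "r (X \<inter> Y) < r (insert x (X \<inter> Y))" by simp
qed

text \<open>Submodularity, with the union replaced by its closure and the rank of the intersection
  split into cyclic part and coloops. This form is the one required by the hypothesis
  \<open>bounds\<close> of the existence criterion, and is used for two flats of the same
  matroid.\<close>

lemma cyclic_flat_bounds:
  assumes "closed X" "coloop_free X" "closed Y" "coloop_free Y"
  shows "\<exists>J K. closed J \<and> coloop_free J \<and> closed K \<and> coloop_free K \<and> X \<union> Y \<subseteq> J \<and> K \<subseteq> X \<inter> Y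
    \<and> r J + r K + card (X \<inter> Y - K) \<le> r X + r Y"
proof -
  obtain J where J: "X \<union> Y \<subseteq> J" "closed J" "coloop_free J" "r J = r (X \<union> Y)"
    using coloop_free_closure[OF coloop_free_Un] assms by metis
  obtain K where K: "K \<subseteq> X \<inter> Y" "closed K" "coloop_free K"
      "r K + card (X \<inter> Y - K) = r (X \<inter> Y)"
    using closed_kernel[OF closed_Int] assms by metis
  have "r (X \<union> Y) + r (X \<inter> Y) \<le> r X + r Y"
    using assms by (intro r_submodular) (auto simp: closed_def)
  then have "r J + r K + card (X \<inter> Y - K) \<le> r X + r Y" using J K by linarith
  then show ?thesis using J K by blast
qed

lemma r_less_closed:
  assumes "closed X" "X \<subset> Y" "Y \<subseteq> E" shows "r X < r Y"
proof -
  obtain x where x: "x \<in> Y - X" using assms(2) by auto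
  then have "r X < r (insert x X)" using assms by (auto simp: closed_def)
  also have "\<dots> \<le> r Y" using assms x by (intro r_mono) auto
  finally show ?thesis .
qed

lemma nullity_less_coloop_free:
  assumes "coloop_free Y" "X \<subset> Y" shows "r Y + card X < r X + card Y"
proof -
  obtain x where x: "x \<in> Y - X" using assms(2) by auto
  have Y: "Y \<subseteq> E" "finite Y" using assms finite_subset_E by (auto simp: coloop_free_def)
  have "r Y = r (Y - {x})" using assms x by (simp add: coloop_free_def)
  also have "\<dots> \<le> r X + card (Y - {x} - X)"
    using x assms Y by (intro r_diff_le) auto
  also have "card (Y - {x} - X) < card (Y - X)"
    using x Y by (intro psubset_card_mono) auto
  also have "card (Y - X) = card Y - card X"
    using assms Y by (intro card_Diff_subset) (auto intro: finite_subset)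
  finally have "r Y < r X + (card Y - card X)" by simp
  moreover have "card X \<le> card Y" using assms Y by (intro card_mono) auto
  ultimately show ?thesis by simp
qed

section \<open>The dual rank function\<close>

definition dual_r :: "'a set \<Rightarrow> nat" where
  "dual_r X = card X + r (E - X) - r E"

text \<open>Removing X from E costs at most |X| in rank, so the natural number subtraction in
  \<open>dual_r\<close> does not truncate on subsets of E.\<close>

lemma dual_r_eq: "X \<subseteq> E \<Longrightarrow> dual_r X + r E = card X + r (E - X)"
  using r_diff_le[of E "E - X"] by (simp add: dual_r_def double_diff)

lemma rank_function_dual: "rank_function E dual_r"
proof
  show "finite E" by (rule finite_E)
next
  fix X assume "X \<subseteq> E"
  then show "dual_r X \<le> card X" using dual_r_eq[of X] r_mono[of "E - X" E] by simp
next
  fix X Y assume XY: "X \<subseteq> Y" "Y \<subseteq> E"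
  then have X: "X \<subseteq> E" by simp
  have "(E - X) - (E - Y) = Y - X" using XY by auto
  then have "r (E - X) \<le> r (E - Y) + card (Y - X)"
    using r_diff_le[of "E - X" "E - Y"] XY by auto
  moreover have "card Y = card X + card (Y - X)"
    using XY finite_subset_E card_Diff_subset[of X Y] card_mono[of Y X] by fastforce
  ultimately show "dual_r X \<le> dual_r Y"
    using dual_r_eq[OF X] dual_r_eq[OF XY(2)] by linarith
next
  fix X Y assume XY: "X \<subseteq> E" "Y \<subseteq> E"
  have "(E - X) \<inter> (E - Y) = E - (X \<union> Y)" "(E - X) \<union> (E - Y) = E - X \<inter> Y" by auto
  then have "r (E - X \<inter> Y) + r (E - (X \<union> Y)) \<le> r (E - X) + r (E - Y)"
    using r_submodular[of "E - X" "E - Y"] by auto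
  moreover have "card (X \<union> Y) + card (X \<inter> Y) = card X + card Y"
    using XY finite_subset_E card_Un_Int by metis
  moreover have "X \<union> Y \<subseteq> E" "X \<inter> Y \<subseteq> E" using XY by auto
  ultimately show "dual_r (X \<union> Y) + dual_r (X \<inter> Y) \<le> dual_r X + dual_r Y"
    using XY dual_r_eq[of X] dual_r_eq[of Y] dual_r_eq[of "X \<union> Y"] dual_r_eq[of "X \<inter> Y"]
    by linarith
qed

end

text \<open>Adding x \<in> F to E - F raises the dual rank by 1 minus the drop from r F to r (F -
  {x}); removing x \<in> E - F from E - F lowers it by 1 minus the gain from r F to r (insert x F).
  All these changes are 0 or 1, so each condition turns into the other.\<close>

lemma rank_function_dual_closed_iff:
  assumes "rank_function E r" "F \<subseteq> E"
  shows "rank_function.closed E (rank_function.dual_r E r) (E - F) \<longleftrightarrow> rank_function.coloop_free E r F"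
    and "rank_function.coloop_free E (rank_function.dual_r E r) (E - F) \<longleftrightarrow> rank_function.closed E r F"
proof -
  interpret rank_function E r by fact
  interpret d: rank_function E dual_r by (rule rank_function_dual)
  have fin: "finite (E - F)" using finite_E by simp
  have 1: "dual_r (E - F) + r E = card (E - F) + r F"
    using dual_r_eq[of "E - F"] assms(2) by (simp add: double_diff)
  have "dual_r (insert x (E - F)) + r E = Suc (card (E - F)) + r (F - {x})"
    if "x \<in> F" for x
  proof -
    have "E - insert x (E - F) = F - {x}" using assms(2) by auto
    then show ?thesis
      using dual_r_eq[of "insert x (E - F)"] that assms(2) fin by auto
  qed
  moreover have "r (F - {x}) \<le> r F \<and> r F \<le> Suc (r (F - {x}))" if "x \<in> F" for x
    using r_diff_le[of F "F - {x}"] r_mono[of "F - {x}" F] assms(2) that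
    by (simp add: double_diff)
  ultimately have "dual_r (E - F) < dual_r (insert x (E - F)) \<longleftrightarrow> r (F - {x}) = r F"
    if "x \<in> F" for x
    using that 1 by fastforce
  then show "d.closed (E - F) \<longleftrightarrow> coloop_free F"
    using assms(2) by (auto simp: d.closed_def coloop_free_def)
  have "Suc (dual_r (E - F - {x}) + r E) = card (E - F) + r (insert x F)"
    if "x \<in> E - F" for x
  proof -
    have "E - (E - F - {x}) = insert x F" using assms(2) that by auto
    moreover have "Suc (card (E - F - {x})) = card (E - F)"
      using that fin by (metis card.remove)
    ultimately show ?thesis
      using dual_r_eq[of "E - F - {x}"] by (simp add: Diff_subset subset_iff)
  qed
  moreover have "r F \<le> r (insert x F) \<and> r (insert x F) \<le> Suc (r F)" if "x \<in> E - F" for x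
    using r_Un_le[of F "{x}"] r_mono[of F "insert x F"] assms(2) that by auto
  ultimately have "dual_r (E - F - {x}) = dual_r (E - F) \<longleftrightarrow> r F < r (insert x F)"
    if "x \<in> E - F" for x
    using that 1 by fastforce
  then show "d.coloop_free (E - F) \<longleftrightarrow> closed F"
    using assms(2) by (auto simp: d.coloop_free_def closed_def)
qed

section \<open>Matroids, their cyclic flats and duals\<close>

lemma matroid_finite: "matroid M \<Longrightarrow> finite (ground M)"
  by (simp add: matroid_def)

lemma indep_subset_ground: "matroid M \<Longrightarrow> I \<in> indeps M \<Longrightarrow> I \<subseteq> ground M"
  by (auto simp: matroid_def)

lemma indep_finite: "matroid M \<Longrightarrow> I \<in> indeps M \<Longrightarrow> finite I"
  using indep_subset_ground matroid_finite finite_subset by metis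

lemma indep_subset: "matroid M \<Longrightarrow> I \<in> indeps M \<Longrightarrow> J \<subseteq> I \<Longrightarrow> J \<in> indeps M"
  unfolding matroid_def by blast

lemma indep_empty: "matroid M \<Longrightarrow> {} \<in> indeps M"
  by (simp add: matroid_def)

lemma indep_augment:
  assumes "matroid M" "I \<in> indeps M" "J \<in> indeps M" "card I < card J"
  obtains x where "x \<in> J - I" "insert x I \<in> indeps M"
proof -
  have "\<forall>I\<in>indeps M. \<forall>J\<in>indeps M. card I < card J \<longrightarrow> (\<exists>x\<in>J - I. insert x I \<in> indeps M)"
    using assms(1) by (simp add: matroid_def)
  then have "\<exists>x\<in>J - I. insert x I \<in> indeps M"
    using assms(2-4) by simp
  then show ?thesis using that by blast
qed

lemma finite_indeps: "matroid M \<Longrightarrow> finite (indeps M)"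
  by (auto simp: matroid_def intro: finite_subset[of _ "Pow (ground M)"])

lemma card_le_rank:
  assumes "matroid M" "I \<in> indeps M" "I \<subseteq> X" shows "card I \<le> rank M X"
  unfolding rank_def using assms finite_indeps[OF assms(1)] by (intro Max_ge) auto

lemma rank_attained:
  assumes "matroid M"
  obtains I where "I \<in> indeps M" "I \<subseteq> X" "card I = rank M X"
proof -
  have "rank M X \<in> card ` {I \<in> indeps M. I \<subseteq> X}"
    unfolding rank_def using assms finite_indeps[of M] indep_empty[of M] by (intro Max_in) auto
  then show ?thesis using that by auto
qed

lemma indep_extend:
  assumes "matroid M" "I \<in> indeps M" "I \<subseteq> X"
  shows "\<exists>J. J \<in> indeps M \<and> I \<subseteq> J \<and> J \<subseteq> X \<and> card J = rank M X"
  using assms(2,3)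
proof (induction "rank M X - card I" arbitrary: I)
  case 0
  then have "card I = rank M X" using card_le_rank[OF assms(1) 0(2,3)] by simp
  then show ?case using 0 by blast
next
  case (Suc n)
  obtain B where B: "B \<in> indeps M" "B \<subseteq> X" "card B = rank M X"
    using rank_attained[OF assms(1)] by blast
  then have "card I < card B" using Suc(2) by simp
  then obtain x where x: "x \<in> B - I" "insert x I \<in> indeps M"
    using indep_augment[OF assms(1) Suc.prems(1) B(1)] by blast
  have "n = rank M X - card (insert x I)"
    using Suc x indep_finite[OF assms(1) Suc.prems(1)] by simp
  then obtain J where "J \<in> indeps M \<and> insert x I \<subseteq> J \<and> J \<subseteq> X \<and> card J = rank M X"
    using Suc(1)[of "insert x I"] x B Suc.prems by blast
  then show ?case by blast
qed

lemma indep_iff_rank: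
  assumes "matroid M" "I \<subseteq> ground M"
  shows "I \<in> indeps M \<longleftrightarrow> rank M I = card I"
proof
  have fin: "finite I" using assms matroid_finite finite_subset by metis
  obtain J where J: "J \<in> indeps M" "J \<subseteq> I" "card J = rank M I"
    using rank_attained[OF assms(1)] by blast
  show "rank M I = card I" if "I \<in> indeps M"
    using card_le_rank[OF assms(1) that, of I] card_mono[OF fin J(2)] J(3) by simp
  show "I \<in> indeps M" if "rank M I = card I"
    using J card_subset_eq[OF fin J(2)] that by simp
qed

lemma rank_function_rank:
  assumes M: "matroid M" shows "rank_function (ground M) (rank M)"
proof
  show "finite (ground M)" using M by (rule matroid_finite)
next
  fix X assume "X \<subseteq> ground M"
  then have "finite X" using M matroid_finite finite_subset by metis
  then show "rank M X \<le> card X" using rank_attained[OF M, of X] card_mono by metis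
next
  fix X Y assume "X \<subseteq> Y" "Y \<subseteq> ground M"
  then show "rank M X \<le> rank M Y"
    using rank_attained[OF M, of X] card_le_rank[OF M] subset_trans by metis
next
  fix X Y assume "X \<subseteq> ground M" "Y \<subseteq> ground M"
  obtain I where I: "I \<in> indeps M" "I \<subseteq> X \<inter> Y" "card I = rank M (X \<inter> Y)"
    using rank_attained[OF M] by blast
  \<comment> \<open>A basis of X \<union> Y that extends a basis of X \<inter> Y contains at least
    |I| points of X \<inter> Y; counting its points in X and in Y gives the inequality.\<close>
  obtain J where J: "J \<in> indeps M" "I \<subseteq> J" "J \<subseteq> X \<union> Y" "card J = rank M (X \<union> Y)"
    using indep_extend[OF M I(1), of "X \<union> Y"] I by blast
  have fin: "finite J" using J M indep_finite by blast
  have "card J + card (J \<inter> (X \<inter> Y)) = card (J \<inter> X) + card (J \<inter> Y)"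
  proof -
    have "J \<inter> X \<union> J \<inter> Y = J" "(J \<inter> X) \<inter> (J \<inter> Y) = J \<inter> (X \<inter> Y)" using J by auto
    then show ?thesis using card_Un_Int[of "J \<inter> X" "J \<inter> Y"] fin by simp
  qed
  moreover have "card I \<le> card (J \<inter> (X \<inter> Y))"
    using I J fin by (intro card_mono) auto
  moreover have "card (J \<inter> X) \<le> rank M X" "card (J \<inter> Y) \<le> rank M Y"
    using J M by (auto intro!: card_le_rank indep_subset[OF M J(1)])
  ultimately show "rank M (X \<union> Y) + rank M (X \<inter> Y) \<le> rank M X + rank M Y"
    using I J by linarith
qed

lemma matroid_eqI:
  assumes "matroid M" "matroid N" "ground M = ground N"
    and "\<And>X. X \<subseteq> ground M \<Longrightarrow> rank M X = rank N X"
  shows "M = N"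
proof -
  have "I \<in> indeps M \<longleftrightarrow> I \<in> indeps N" for I
    using assms indep_iff_rank indep_subset_ground by metis
  then show ?thesis using assms(3) by (cases M, cases N) auto
qed

section \<open>Cyclic flats in terms of rank\<close>

lemma coloop_free_iff_Union_circuits:
  assumes M: "matroid M" and F: "F \<subseteq> ground M"
  shows "rank_function.coloop_free (ground M) (rank M) F
    \<longleftrightarrow> (\<exists>\<C>. (\<forall>C\<in>\<C>. circuit M C) \<and> F = \<Union>\<C>)"
proof -
  interpret rank_function "ground M" "rank M" using M by (rule rank_function_rank)
  show ?thesis
  proof
    assume cf: "coloop_free F"
    have "\<exists>C. circuit M C \<and> x \<in> C \<and> C \<subseteq> F" if x: "x \<in> F" for x
    proof -
      \<comment> \<open>The fundamental circuit of x: I is a basis of F - {x}. As x is no coloop,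
        \<open>insert x I\<close> is dependent, and a minimal dependent subset contains x because I
        is independent.\<close>
      obtain I where I: "I \<in> indeps M" "I \<subseteq> F - {x}" "card I = rank M (F - {x})"
        using rank_attained[OF M] by blast
      have "finite I" "x \<notin> I" using I M indep_finite by auto
      then have "insert x I \<notin> indeps M"
        using card_le_rank[OF M, of "insert x I" F] I x cf by (auto simp: coloop_free_def)
      then have dep: "insert x I \<in> {D. D \<subseteq> insert x I \<and> D \<notin> indeps M}" by simp
      have "finite {D. D \<subseteq> insert x I \<and> D \<notin> indeps M}"
        using \<open>finite I\<close> by simp
      from finite_has_minimal2[OF this dep]
      obtain C where "C \<in> {D. D \<subseteq> insert x I \<and> D \<notin> indeps M}"
          "\<forall>D\<in>{D. D \<subseteq> insert x I \<and> D \<notin> indeps M}. D \<subseteq> C \<longrightarrow> C = D"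
        by (elim bexE conjE)
      then have C: "C \<subseteq> insert x I" "C \<notin> indeps M"
          "\<And>D. D \<subseteq> insert x I \<Longrightarrow> D \<notin> indeps M \<Longrightarrow> D \<subseteq> C \<Longrightarrow> C = D"
        by auto
      have CF: "C \<subseteq> F" using C I x by auto
      have "D \<in> indeps M" if "D \<subset> C" for D using C that by blast
      then have "circuit M C" using C CF F by (auto simp: circuit_def)
      moreover have "x \<in> C" using C I indep_subset[OF M I(1), of C] by blast
      ultimately show ?thesis using CF by blast
    qed
    then have "F = \<Union>{C. circuit M C \<and> C \<subseteq> F}" by blast
    then show "\<exists>\<C>. (\<forall>C\<in>\<C>. circuit M C) \<and> F = \<Union>\<C>"
      by (intro exI[of _ "{C. circuit M C \<and> C \<subseteq> F}"]) simp
  next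
    assume "\<exists>\<C>. (\<forall>C\<in>\<C>. circuit M C) \<and> F = \<Union>\<C>"
    then obtain \<C> where \<C>: "\<forall>C\<in>\<C>. circuit M C" "F = \<Union>\<C>" by blast
    have "rank M (F - {x}) = rank M F" if x: "x \<in> F" for x
    proof (rule antisym)
      show "rank M (F - {x}) \<le> rank M F" using F by (intro r_mono) auto
      obtain C where C: "circuit M C" "x \<in> C" "C \<subseteq> F" using \<C> x by auto
      have "C - {x} \<subset> C" using C(2) by blast
      then have "C - {x} \<in> indeps M" using C(1) by (simp add: circuit_def)
      \<comment> \<open>Extend C - {x} to a basis of F - {x} and then to a basis J of F. If x were
        in J, then J would contain the circuit C; so J already lies in F - {x}.\<close>
      then obtain I where I: "I \<in> indeps M" "C - {x} \<subseteq> I" "I \<subseteq> F - {x}"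
          "card I = rank M (F - {x})"
        using indep_extend[OF M, of "C - {x}" "F - {x}"] C by blast
      obtain J where J: "J \<in> indeps M" "I \<subseteq> J" "J \<subseteq> F" "card J = rank M F"
        using indep_extend[OF M I(1), of F] I by blast
      have "x \<notin> J"
      proof
        assume "x \<in> J"
        then have "C \<subseteq> J" using I J by blast
        then show False using indep_subset[OF M J(1)] C by (auto simp: circuit_def)
      qed
      then show "rank M F \<le> rank M (F - {x})"
        using card_le_rank[OF M J(1), of "F - {x}"] J by auto
    qed
    then show "coloop_free F" using F by (simp add: coloop_free_def)
  qed
qed

lemma cyclic_flat_iff:
  assumes "matroid M"
  shows "cyclic_flat M F \<longleftrightarrow> rank_function.closed (ground M) (rank M) F
    \<and> rank_function.coloop_free (ground M) (rank M) F"
proof -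
  interpret rank_function "ground M" "rank M" using assms by (rule rank_function_rank)
  show ?thesis
    using coloop_free_iff_Union_circuits[OF assms, of F]
    by (auto simp: cyclic_flat_def flat_def closed_def)
qed

lemma cyclic_flat_subset_ground: "cyclic_flat M F \<Longrightarrow> F \<subseteq> ground M"
  by (simp add: cyclic_flat_def flat_def)

lemma matroid_eqI_cyclic_flats:
  assumes "matroid M" "matroid N" "ground M = ground N"
    and eq: "\<And>Z. cyclic_flat M Z \<longleftrightarrow> cyclic_flat N Z"
    and rank: "\<And>Z. cyclic_flat M Z \<Longrightarrow> rank M Z = rank N Z"
  shows "M = N"
proof (rule matroid_eqI)
  \<comment> \<open>The cyclic flat where B attains the rank of X bounds the rank in A as well,
    since A and B agree on it. Exchanging the roles gives equality.\<close>
  have le: "rank A X \<le> rank B X"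
    if AB: "matroid A" "matroid B" "ground A = ground B" "X \<subseteq> ground A"
      "\<And>Z. cyclic_flat B Z \<Longrightarrow> rank B Z = rank A Z" for A B :: "'a matroid" and X
  proof -
    interpret A: rank_function "ground A" "rank A" using that by (intro rank_function_rank)
    interpret B: rank_function "ground B" "rank B" using that by (intro rank_function_rank)
    obtain Z where Z: "cyclic_flat B Z" "rank B X = rank B Z + card (X - Z)"
      using B.r_attained[of X] AB(3,4) cyclic_flat_iff[OF AB(2)] by auto
    have ZE: "Z \<subseteq> ground A" using cyclic_flat_subset_ground[OF Z(1)] that by simp
    have "rank A X \<le> rank A (Z \<union> (X - Z))"
      using that ZE by (intro A.r_mono) auto
    also have "\<dots> \<le> rank A Z + card (X - Z)"
      using that ZE by (intro A.r_Un_le) auto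
    finally show ?thesis using Z that(5) by simp
  qed
  fix X assume "X \<subseteq> ground M"
  then show "rank M X = rank N X"
    using le[of M N X] le[of N M X] assms by (intro antisym) auto
qed fact+

section \<open>The dual matroid and its cyclic flats\<close>

lemma basis_iff:
  assumes M: "matroid M"
  shows "basis M B \<longleftrightarrow> B \<in> indeps M \<and> card B = total_rank M"
proof
  assume B: "basis M B"
  then have "B \<in> indeps M" by (simp add: basis_def)
  then obtain J where "J \<in> indeps M" "B \<subseteq> J" "card J = total_rank M"
    using indep_extend[OF M] indep_subset_ground[OF M] by metis
  then show "B \<in> indeps M \<and> card B = total_rank M" using B by (auto simp: basis_def)
next
  assume B: "B \<in> indeps M \<and> card B = total_rank M"
  have "I = B" if "I \<in> indeps M" "B \<subseteq> I" for I
  proof -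
    have "card I \<le> card B"
      using card_le_rank[OF M that(1)] indep_subset_ground[OF M that(1)] B by simp
    then show ?thesis using card_seteq indep_finite[OF M that(1)] that(2) by metis
  qed
  then show "basis M B" using B by (auto simp: basis_def)
qed

text \<open>I avoids some basis iff its complement has full rank, that is, iff the two rank terms in
  \<open>dual_r\<close> cancel and leave |I|.\<close>

lemma dual_eq_to_matroid:
  assumes M: "matroid M"
  shows "dual M = rank_function.to_matroid (ground M) (rank_function.dual_r (ground M) (rank M))"
proof -
  interpret rank_function "ground M" "rank M" using M by (rule rank_function_rank)
  interpret d: rank_function "ground M" dual_r by (rule rank_function_dual)
  have "(\<exists>B. basis M B \<and> I \<subseteq> ground M - B) \<longleftrightarrow> I \<subseteq> ground M \<and> dual_r I = card I" for I
  proof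
    assume "\<exists>B. basis M B \<and> I \<subseteq> ground M - B"
    then obtain B where B: "basis M B" "I \<subseteq> ground M - B" by blast
    then have B': "B \<in> indeps M" "card B = total_rank M" using basis_iff[OF M] by auto
    have "B \<subseteq> ground M - I" using B indep_subset_ground[OF M B'(1)] by auto
    then have "total_rank M \<le> rank M (ground M - I)"
      using card_le_rank[OF M B'(1)] B'(2) by metis
    moreover have "rank M (ground M - I) \<le> total_rank M" by (intro r_mono) auto
    ultimately show "I \<subseteq> ground M \<and> dual_r I = card I"
      using B by (auto simp: dual_r_def)
  next
    assume I: "I \<subseteq> ground M \<and> dual_r I = card I"
    then have "rank M (ground M - I) = total_rank M" using dual_r_eq[of I] by simp
    then obtain B where "B \<in> indeps M" "B \<subseteq> ground M - I" "card B = total_rank M"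
      using rank_attained[OF M] by metis
    then have "basis M B" "I \<subseteq> ground M - B" using basis_iff[OF M] I by auto
    then show "\<exists>B. basis M B \<and> I \<subseteq> ground M - B" by blast
  qed
  then show ?thesis by (simp add: dual_def d.to_matroid_def)
qed

lemma ground_dual [simp]: "ground (dual M) = ground M"
  by (simp add: dual_def)

lemma matroid_dual:
  assumes "matroid M" shows "matroid (dual M)"
  using rank_function.matroid_to_matroid rank_function.rank_function_dual
    rank_function_rank[OF assms] dual_eq_to_matroid[OF assms] by metis

lemma rank_dual_eq_dual_r:
  assumes M: "matroid M" and X: "X \<subseteq> ground M"
  shows "rank (dual M) X = rank_function.dual_r (ground M) (rank M) X"
  using rank_function.rank_to_matroid[OF rank_function.rank_function_dual X]
    rank_function_rank[OF M] dual_eq_to_matroid[OF M] by metis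

lemma rank_dual:
  assumes "matroid M" "X \<subseteq> ground M"
  shows "rank (dual M) X + total_rank M = card X + rank M (ground M - X)"
  using rank_dual_eq_dual_r[OF assms]
    rank_function.dual_r_eq[OF rank_function_rank[OF assms(1)] assms(2)] by simp

lemma cyclic_flat_dual_iff:
  assumes M: "matroid M" and F: "F \<subseteq> ground M"
  shows "cyclic_flat (dual M) (ground M - F) \<longleftrightarrow> cyclic_flat M F"
proof -
  interpret rank_function "ground M" "rank M" using M by (rule rank_function_rank)
  interpret d: rank_function "ground M" dual_r by (rule rank_function_dual)
  \<comment> \<open>\<open>rank (dual M)\<close> and \<open>dual_r\<close> are known to agree only
    on subsets of the ground set, so they are separate interpretations whose closed and coloop-free
    sets have to be matched.\<close>
  interpret d': rank_function "ground M" "rank (dual M)"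
    using rank_function_rank[OF matroid_dual[OF M]] by simp
  have "rank (dual M) X = dual_r X" if "X \<subseteq> ground M" for X
    using rank_dual_eq_dual_r[OF M that] by simp
  then have "d'.closed (ground M - F) = d.closed (ground M - F)"
    "d'.coloop_free (ground M - F) = d.coloop_free (ground M - F)"
    unfolding d'.closed_def d.closed_def d'.coloop_free_def d.coloop_free_def
    by (auto simp: Diff_subset subset_iff)
  then show ?thesis
    using rank_function_dual_closed_iff[OF rank_function_rank[OF M] F]
      cyclic_flat_iff[OF M] cyclic_flat_iff[OF matroid_dual[OF M]] by auto
qed

lemma cyclic_flats_dual:
  assumes "matroid M"
  shows "{Z. cyclic_flat (dual M) Z} = (\<lambda>F. ground M - F) ` {F. cyclic_flat M F}"
proof (intro set_eqI iffI)
  fix Z assume "Z \<in> {Z. cyclic_flat (dual M) Z}"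
  then have Z: "cyclic_flat (dual M) Z" "Z \<subseteq> ground M"
    using cyclic_flat_subset_ground by fastforce+
  then have Z': "ground M - (ground M - Z) = Z" by auto
  then have "cyclic_flat M (ground M - Z)"
    using Z(1) cyclic_flat_dual_iff[OF assms, of "ground M - Z"] by auto
  then show "Z \<in> (\<lambda>F. ground M - F) ` {F. cyclic_flat M F}" using Z' by blast
next
  fix Z assume "Z \<in> (\<lambda>F. ground M - F) ` {F. cyclic_flat M F}"
  then show "Z \<in> {Z. cyclic_flat (dual M) Z}"
    using cyclic_flat_dual_iff[OF assms] cyclic_flat_subset_ground by auto
qed

lemma proper_cyclic_flats_dual:
  assumes "matroid M"
  shows "proper_cyclic_flats (dual M) = (\<lambda>F. ground M - F) ` proper_cyclic_flats M"
proof -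
  have "proper_cyclic_flats (dual M) = {Z. cyclic_flat (dual M) Z} - {{}, ground M}"
    by (auto simp: proper_cyclic_flats_def)
  also have "\<dots> = (\<lambda>F. ground M - F) ` ({F. cyclic_flat M F} - {{}, ground M})"
    unfolding cyclic_flats_dual[OF assms] using cyclic_flat_subset_ground[of M] by auto
  also have "{F. cyclic_flat M F} - {{}, ground M} = proper_cyclic_flats M"
    by (auto simp: proper_cyclic_flats_def)
  finally show ?thesis .
qed

section \<open>Matroids with prescribed cyclic flats\<close>

text \<open>The usual axioms ask for a lattice; submodularity only needs a bound \<open>J\<close> above and a bound
  \<open>K\<close> below in place of the join and the meet.\<close>

lemma exists_matroid_with_cyclic_flats:
  fixes \<rho> :: "'a set \<Rightarrow> nat"
  assumes E: "finite E" and \<Z>: "\<Z> \<subseteq> Pow E" and zero: "Z0 \<in> \<Z>" "\<rho> Z0 = 0"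
    and strict: "\<And>X Y. X \<in> \<Z> \<Longrightarrow> Y \<in> \<Z> \<Longrightarrow> X \<subset> Y \<Longrightarrow> \<rho> X < \<rho> Y \<and> \<rho> Y + card X < \<rho> X + card Y"
    and bounds: "\<And>X Y. X \<in> \<Z> \<Longrightarrow> Y \<in> \<Z> \<Longrightarrow> \<exists>J\<in>\<Z>. \<exists>K\<in>\<Z>. X \<union> Y \<subseteq> J \<and> K \<subseteq> X \<inter> Y
      \<and> \<rho> J + \<rho> K + card (X \<inter> Y - K) \<le> \<rho> X + \<rho> Y"
  shows "\<exists>M. matroid M \<and> ground M = E \<and> (\<forall>Z. cyclic_flat M Z \<longleftrightarrow> Z \<in> \<Z>) \<and> (\<forall>Z\<in>\<Z>. rank M Z = \<rho> Z)"
proof -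
  define r where "r X = Min ((\<lambda>Z. \<rho> Z + card (X - Z)) ` \<Z>)" for X
  have finZ: "finite \<Z>" using E \<Z> by (meson finite_Pow_iff finite_subset)
  have fin: "finite X" if "X \<subseteq> E" for X using E that finite_subset by blast
  have le: "r X \<le> \<rho> Z + card (X - Z)" if "Z \<in> \<Z>" for X Z
    unfolding r_def using that finZ by (intro Min_le) auto
  have att: "\<exists>Z\<in>\<Z>. r X = \<rho> Z + card (X - Z)" for X
  proof -
    have "r X \<in> (\<lambda>Z. \<rho> Z + card (X - Z)) ` \<Z>"
      unfolding r_def using finZ zero by (intro Min_in) auto
    then show ?thesis by auto
  qed
  interpret rank_function E r
  proof
    show "finite E" by fact
  next
    fix X assume X: "X \<subseteq> E"
    have "r X \<le> card (X - Z0)" using le[OF zero(1), of X] zero by simp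
    also have "\<dots> \<le> card X" using fin[OF X] by (intro card_mono) auto
    finally show "r X \<le> card X" .
  next
    fix X Y assume XY: "X \<subseteq> Y" "Y \<subseteq> E"
    obtain Z where Z: "Z \<in> \<Z>" "r Y = \<rho> Z + card (Y - Z)" using att by blast
    have "card (X - Z) \<le> card (Y - Z)" using XY fin by (intro card_mono) auto
    then show "r X \<le> r Y" using le[OF Z(1), of X] Z by simp
  next
    fix X Y assume XY: "X \<subseteq> E" "Y \<subseteq> E"
    obtain A where A: "A \<in> \<Z>" "r X = \<rho> A + card (X - A)" using att by blast
    obtain B where B: "B \<in> \<Z>" "r Y = \<rho> B + card (Y - B)" using att by blast
    obtain J K where JK: "J \<in> \<Z>" "K \<in> \<Z>" "A \<union> B \<subseteq> J" "K \<subseteq> A \<inter> B"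
        "\<rho> J + \<rho> K + card (A \<inter> B - K) \<le> \<rho> A + \<rho> B"
      using bounds[OF A(1) B(1)] by blast
    have finX: "finite X" "finite Y" "finite A" using XY fin A \<Z> by auto
    have 1: "card (X \<inter> Y - K) \<le> card (X \<inter> Y - A \<inter> B) + card (A \<inter> B - K)"
    proof -
      have "card (X \<inter> Y - K) \<le> card ((X \<inter> Y - A \<inter> B) \<union> (A \<inter> B - K))"
        using finX by (intro card_mono) auto
      also have "\<dots> \<le> card (X \<inter> Y - A \<inter> B) + card (A \<inter> B - K)" by (rule card_Un_le)
      finally show ?thesis .
    qed
    \<comment> \<open>After enlarging X \<union> Y - J to X \<union> Y - (A \<union> B), the two
      sets on the left have their union inside (X - A) \<union> (Y - B) and their intersection
      inside (X - A) \<inter> (Y - B), so the modular count applies.\<close>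
    have 2: "card (X \<union> Y - J) + card (X \<inter> Y - A \<inter> B) \<le> card (X - A) + card (Y - B)"
    proof -
      have "card (X \<union> Y - J) \<le> card (X \<union> Y - (A \<union> B))"
        using finX JK by (intro card_mono) auto
      moreover have "card (X \<union> Y - (A \<union> B)) + card (X \<inter> Y - A \<inter> B)
          = card ((X \<union> Y - (A \<union> B)) \<union> (X \<inter> Y - A \<inter> B)) + card ((X \<union> Y - (A \<union> B)) \<inter> (X \<inter> Y - A \<inter> B))"
        using finX by (intro card_Un_Int) auto
      moreover have "card ((X \<union> Y - (A \<union> B)) \<union> (X \<inter> Y - A \<inter> B)) \<le> card ((X - A) \<union> (Y - B))"
        using finX by (intro card_mono) auto
      moreover have "card ((X \<union> Y - (A \<union> B)) \<inter> (X \<inter> Y - A \<inter> B)) \<le> card ((X - A) \<inter> (Y - B))"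
        using finX by (intro card_mono) auto
      moreover have "card (X - A) + card (Y - B) = card ((X - A) \<union> (Y - B)) + card ((X - A) \<inter> (Y - B))"
        using finX by (intro card_Un_Int) auto
      ultimately show ?thesis by linarith
    qed
    show "r (X \<union> Y) + r (X \<inter> Y) \<le> r X + r Y"
      using le[OF JK(1), of "X \<union> Y"] le[OF JK(2), of "X \<inter> Y"] JK(5) A B 1 2 by linarith
  qed
  \<comment> \<open>At Z the minimum is attained by Z alone. Add \<rho> Z \<le> \<rho> J and \<rho>
    Z \<le> \<rho> K + |Z - K| to the bound for Z and A. The first is strict if A sticks out of Z,
    the second if Z sticks out of A. The plain inequality gives \<open>rZ\<close>; the two strict
    ones are needed for \<open>cl\<close> and \<open>cf\<close>.\<close>
  have ge: "\<rho> Z \<le> \<rho> A + card (Z - A)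
      \<and> (\<not> A \<subseteq> Z \<longrightarrow> \<rho> Z < \<rho> A + card (Z - A)) \<and> (\<not> Z \<subseteq> A \<longrightarrow> \<rho> Z < \<rho> A + card (Z - A))"
    if Z: "Z \<in> \<Z>" and A: "A \<in> \<Z>" for A Z
  proof -
    obtain J K where JK: "J \<in> \<Z>" "K \<in> \<Z>" "Z \<union> A \<subseteq> J" "K \<subseteq> Z \<inter> A"
        "\<rho> J + \<rho> K + card (Z \<inter> A - K) \<le> \<rho> Z + \<rho> A"
      using bounds[OF Z A] by blast
    have finZ: "finite Z" using Z \<Z> fin by auto
    have "Z \<subseteq> J" using JK by auto
    then have "\<rho> Z \<le> \<rho> J"
      using strict[OF Z JK(1)] by (cases "Z = J") (simp_all add: psubset_eq)
    moreover have "\<rho> Z < \<rho> J" if "\<not> A \<subseteq> Z" using strict[of Z J] JK Z that by auto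
    moreover have "\<rho> Z \<le> \<rho> K + card (Z - K)" if "K \<subseteq> Z"
    proof (cases "K = Z")
      case False
      then have "K \<subset> Z" using that by blast
      then show ?thesis
        using strict[OF JK(2) Z] finZ that card_Diff_subset[of K Z] card_mono[of Z K]
          finite_subset[of K Z] by linarith
    qed simp
    moreover have "\<rho> Z < \<rho> K + card (Z - K)" if "\<not> Z \<subseteq> A"
    proof -
      have "K \<subset> Z" using JK that by auto
      moreover from this have "card (Z - K) = card Z - card K"
        using finZ finite_subset[of K Z] by (intro card_Diff_subset) auto
      ultimately show ?thesis using strict[OF JK(2) Z] by linarith
    qed
    moreover have "card (Z - K) = card (Z \<inter> A - K) + card (Z - A)"
    proof -
      have "Z - K = (Z \<inter> A - K) \<union> (Z - A)" using JK by auto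
      then show ?thesis
        using card_Un_disjoint[of "Z \<inter> A - K" "Z - A"] finZ by auto
    qed
    moreover have "K \<subseteq> Z" using JK by auto
    ultimately show ?thesis using JK(5) by linarith
  qed
  have rZ: "r Z = \<rho> Z" if Z: "Z \<in> \<Z>" for Z
  proof (rule antisym)
    show "r Z \<le> \<rho> Z" using le[OF Z, of Z] by simp
    show "\<rho> Z \<le> r Z" using att[of Z] ge[OF Z] by auto
  qed
  have cl: "closed Z" if Z: "Z \<in> \<Z>" for Z
  proof -
    have "r Z < r (insert x Z)" if x: "x \<in> E - Z" for x
    proof -
      obtain A where A: "A \<in> \<Z>" "r (insert x Z) = \<rho> A + card (insert x Z - A)" using att by blast
      have finZ: "finite Z" using Z \<Z> fin by auto
      show ?thesis
      proof (cases "x \<in> A")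
        case True
        then have "insert x Z - A = Z - A" by auto
        then show ?thesis using A ge[OF Z A(1)] True x rZ[OF Z] by auto
      next
        case False
        then have "insert x Z - A = insert x (Z - A)" by auto
        then have "card (insert x Z - A) = Suc (card (Z - A))" using finZ x by simp
        then show ?thesis using A ge[OF Z A(1)] rZ[OF Z] by auto
      qed
    qed
    then show ?thesis using Z \<Z> by (auto simp: closed_def)
  qed
  have cf: "coloop_free Z" if Z: "Z \<in> \<Z>" for Z
  proof -
    have "r (Z - {x}) = r Z" if x: "x \<in> Z" for x
    proof (rule antisym)
      show "r (Z - {x}) \<le> r Z" using Z \<Z> by (intro r_mono) auto
      obtain A where A: "A \<in> \<Z>" "r (Z - {x}) = \<rho> A + card (Z - {x} - A)" using att by blast
      have finZ: "finite Z" using Z \<Z> fin by auto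
      show "r Z \<le> r (Z - {x})"
      proof (cases "x \<in> A")
        case True
        then have "Z - {x} - A = Z - A" by auto
        then show ?thesis using A ge[OF Z A(1)] rZ[OF Z] by auto
      next
        case False
        then have "Z - A = insert x (Z - {x} - A)" using x by auto
        then have "card (Z - A) = Suc (card (Z - {x} - A))" using finZ by simp
        moreover have "\<not> Z \<subseteq> A" using False x by auto
        ultimately show ?thesis using A ge[OF Z A(1)] rZ[OF Z] by auto
      qed
    qed
    then show ?thesis using Z \<Z> by (auto simp: coloop_free_def)
  qed
  \<comment> \<open>A point of W outside the minimiser A would be a coloop of W, so W \<subseteq> A;
    closedness rules out a proper inclusion, since r A = r W.\<close>
  have conv: "W \<in> \<Z>" if W: "closed W" "coloop_free W" for W
  proof -
    obtain A where A: "A \<in> \<Z>" "r W = \<rho> A + card (W - A)" using att by blast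
    have WE: "W \<subseteq> E" using W by (simp add: closed_def)
    have "W \<subseteq> A"
    proof
      fix x assume x: "x \<in> W"
      show "x \<in> A"
      proof (rule ccontr)
        assume "x \<notin> A"
        then have "card (W - {x} - A) < card (W - A)"
          using x fin[OF WE] by (intro psubset_card_mono) auto
        then have "r (W - {x}) < r W" using le[OF A(1), of "W - {x}"] A by simp
        then show False using W x by (simp add: coloop_free_def)
      qed
    qed
    moreover have "\<not> W \<subset> A"
    proof
      assume WA: "W \<subset> A"
      have "A \<subseteq> E" using A \<Z> by auto
      then have "r W < r A" using r_less_closed[OF W(1) WA] by simp
      moreover have "W - A = {}" using WA by auto
      ultimately show False using A rZ[OF A(1)] by simp
    qed
    ultimately show ?thesis using A by auto
  qed
  have m: "matroid to_matroid" by (rule matroid_to_matroid)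
  interpret m: rank_function E "rank to_matroid"
    using rank_function_rank[OF m] by simp
  have "m.closed W \<longleftrightarrow> closed W" "m.coloop_free W \<longleftrightarrow> coloop_free W" for W
    unfolding m.closed_def closed_def m.coloop_free_def coloop_free_def
    by (auto simp: rank_to_matroid Diff_subset subset_iff)
  then have "cyclic_flat to_matroid W \<longleftrightarrow> closed W \<and> coloop_free W" for W
    using cyclic_flat_iff[OF m, of W] by simp
  then have "cyclic_flat to_matroid W \<longleftrightarrow> W \<in> \<Z>" for W
    using cl[of W] cf[of W] conv[of W] by blast
  moreover have "rank to_matroid Z = \<rho> Z" if "Z \<in> \<Z>" for Z
    using rank_to_matroid[of Z] rZ[OF that] that \<Z> by auto
  ultimately show ?thesis using m by (intro exI[of _ to_matroid]) simp
qed

section \<open>Existence of $M_k$\<close>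

text \<open>Sizes and the bound on k are written as sums to avoid subtraction of natural numbers.
  \<open>corank1\<close> and \<open>corank2\<close> say that neither matroid is free, which keeps
  the nullity of E positive.\<close>

locale Mk_data =
  fixes N1 N2 :: "'a matroid" and A1 U1 A2 U2 :: "'a set" and k :: nat
  assumes N1: "matroid N1" and N2: "matroid N2"
    and rank1: "0 < total_rank N1" and rank2: "0 < total_rank N2"
    and corank1: "total_rank N1 < card (ground N1)" and corank2: "total_rank N2 < card (ground N2)"
    and A1: "A1 \<subseteq> ground N1" and A2: "A2 \<subseteq> ground N2"
    and finite_U1: "finite U1" and finite_U2: "finite U2"
    and disj: "ground N1 \<inter> ground N2 = {}" "U1 \<inter> U2 = {}"
      "U1 \<inter> (ground N1 \<union> ground N2) = {}" "U2 \<inter> (ground N1 \<union> ground N2) = {}"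
    and card_U1: "total_rank N1 + card U1 + card A2 = k"
    and card_U2: "total_rank N2 + card U2 + card A1 = k"
    and k_ge: "total_rank N1 + card A1 + total_rank N2 + card A2 \<le> k + rank N1 A1 + rank N2 A2"
begin

text \<open>Everything below is proved for the side of N1 and read off for N2 through this
  instance.\<close>

lemma swap: "Mk_data N2 N1 A2 U2 A1 U1 k"
  using N1 N2 rank1 rank2 corank1 corank2 A1 A2 finite_U1 finite_U2 disj card_U1 card_U2 k_ge
  by unfold_locales auto

definition E :: "'a set" where
  "E = ground N1 \<union> ground N2 \<union> U1 \<union> U2"

definition lift :: "'a set \<Rightarrow> 'a set" where
  "lift F = F \<union> U1 \<union> A2"

definition lift_rank :: "'a set \<Rightarrow> nat" where
  "lift_rank F = rank N1 F + card U1 + card A2"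

sublocale R1: rank_function "ground N1" "rank N1"
  using N1 by (rule rank_function_rank)

sublocale R2: rank_function "ground N2" "rank N2"
  using N2 by (rule rank_function_rank)

lemma finite_A: "finite A1" "finite A2"
  using A1 A2 R1.finite_subset_E R2.finite_subset_E by auto

lemma finite_E: "finite E"
  by (simp add: E_def R1.finite_E R2.finite_E finite_U1 finite_U2)

lemma card_E: "card E = card (ground N1) + card (ground N2) + card U1 + card U2"
proof -
  have "card E = card (ground N1 \<union> ground N2 \<union> U1) + card U2"
    unfolding E_def using disj R1.finite_E R2.finite_E finite_U1 finite_U2
    by (intro card_Un_disjoint) auto
  also have "card (ground N1 \<union> ground N2 \<union> U1) = card (ground N1 \<union> ground N2) + card U1"
    using disj R1.finite_E R2.finite_E finite_U1 by (intro card_Un_disjoint) auto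
  also have "card (ground N1 \<union> ground N2) = card (ground N1) + card (ground N2)"
    using disj R1.finite_E R2.finite_E by (intro card_Un_disjoint) auto
  finally show ?thesis .
qed

lemma card_lift:
  assumes "F \<subseteq> ground N1" shows "card (lift F) = card F + card U1 + card A2"
proof -
  have "card (lift F) = card (F \<union> U1) + card A2"
    unfolding lift_def using assms disj A2 finite_A finite_U1 R1.finite_subset_E
    by (intro card_Un_disjoint) auto
  also have "card (F \<union> U1) = card F + card U1"
    using assms disj finite_U1 R1.finite_subset_E by (intro card_Un_disjoint) auto
  finally show ?thesis .
qed

lemma lift_Int_ground: "F \<subseteq> ground N1 \<Longrightarrow> lift F \<inter> ground N1 = F"
  using disj A2 by (auto simp: lift_def)

lemma lift_subset_E: "F \<subseteq> ground N1 \<Longrightarrow> lift F \<subseteq> E"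
  using A2 by (auto simp: lift_def E_def)

lemma pcf_D:
  assumes "F \<in> proper_cyclic_flats N1"
  shows "F \<subset> ground N1" "F \<noteq> {}" "R1.closed F" "R1.coloop_free F" "rank N1 F < card F"
    "rank N1 F < total_rank N1"
proof -
  show *: "F \<subset> ground N1" "F \<noteq> {}" "R1.closed F" "R1.coloop_free F"
    using assms cyclic_flat_iff[OF N1] cyclic_flat_subset_ground
    by (auto simp: proper_cyclic_flats_def)
  show "rank N1 F < card F"
    using R1.nullity_less_coloop_free[OF *(4), of "{}"] * by auto
  show "rank N1 F < total_rank N1"
    using R1.r_less_closed[OF *(3) *(1)] by simp
qed

lemma pcf_I:
  "R1.closed F \<Longrightarrow> R1.coloop_free F \<Longrightarrow> F \<noteq> {} \<Longrightarrow> F \<noteq> ground N1 \<Longrightarrow> F \<in> proper_cyclic_flats N1"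
  using cyclic_flat_iff[OF N1] by (simp add: proper_cyclic_flats_def)

section \<open>Ranks and nullities of the lifted flats\<close>

lemma k_pos: "0 < k"
  using card_U1 rank1 by simp

lemma k_less_card_E: "k < card E"
proof -
  have "rank N1 A1 \<le> total_rank N1" "rank N2 A2 \<le> total_rank N2"
    using A1 A2 by (auto intro: R1.r_mono R2.r_mono)
  then show ?thesis using card_E card_U1 card_U2 k_ge corank1 corank2 by linarith
qed

text \<open>F may consist of loops, so the rank has to come from U1 \<union> A2. If A2 is empty, the
  bound on k gives |U1| \<ge> r(N2) > 0.\<close>

lemma lift_rank_pos:
  assumes "F \<in> proper_cyclic_flats N1" shows "0 < lift_rank F"
proof (cases "A2 = {}")
  case True
  moreover have "rank N1 A1 \<le> card A1" using A1 by (rule R1.r_le_card)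
  ultimately have "0 < card U1" using k_ge rank2 card_U1 by simp
  then show ?thesis by (simp add: lift_rank_def)
next
  case False
  then have "0 < card A2" using finite_A by (simp add: card_gt_0_iff)
  then show ?thesis by (simp add: lift_rank_def)
qed

lemma lift_rank_less_card:
  assumes "F \<in> proper_cyclic_flats N1" shows "lift_rank F < card (lift F)"
  using pcf_D[OF assms] by (simp add: lift_rank_def card_lift psubset_imp_subset)

lemma lift_rank_less_k:
  assumes "F \<in> proper_cyclic_flats N1" shows "lift_rank F < k"
  using pcf_D[OF assms] card_U1 by (simp add: lift_rank_def)

text \<open>A comparison of nullities: that of F is at most that of N1, and the strict gain comes
  from the points of ground N2 and U2 outside \<open>lift F\<close>. If A2 is all of ground N2, the
  bound on k makes |U2| at least the nullity of N2, which \<open>corank2\<close> makes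
  positive.\<close>

lemma lift_corank:
  assumes F: "F \<in> proper_cyclic_flats N1" shows "k + card (lift F) < lift_rank F + card E"
proof -
  have "total_rank N1 + card F \<le> rank N1 F + card (ground N1)"
    using R1.r_diff_le[of "ground N1" F] pcf_D[OF F]
      card_Diff_subset[of F "ground N1"] card_mono[of "ground N1" F] R1.finite_E finite_subset[of F "ground N1"]
    by auto
  moreover have "card A2 < card (ground N2) + card U2"
  proof (cases "A2 = ground N2")
    case True
    have "rank N1 A1 \<le> total_rank N1" using A1 by (auto intro: R1.r_mono)
    then show ?thesis using True k_ge corank2 card_U2 by simp
  next
    case False
    then have "card A2 < card (ground N2)" using A2 R2.finite_E by (intro psubset_card_mono) auto
    then show ?thesis by simp
  qed
  ultimately show ?thesis
    using card_lift[of F] pcf_D(1)[OF F] card_E card_U1 by (auto simp: lift_rank_def)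
qed

lemma lift_strict:
  assumes FG: "F \<in> proper_cyclic_flats N1" "G \<in> proper_cyclic_flats N1" "lift F \<subset> lift G"
  shows "lift_rank F < lift_rank G \<and> lift_rank G + card (lift F) < lift_rank F + card (lift G)"
proof -
  have sub: "F \<subseteq> ground N1" "G \<subseteq> ground N1" using pcf_D(1) FG by auto
  have "F \<noteq> G" using FG(3) by auto
  moreover have "F \<subseteq> G" using lift_Int_ground[OF sub(1)] lift_Int_ground[OF sub(2)] FG(3) by blast
  ultimately have "F \<subset> G" by blast
  then show ?thesis
    using R1.r_less_closed[of F G] R1.nullity_less_coloop_free[of G F] pcf_D FG sub
    by (simp add: lift_rank_def card_lift)
qed

text \<open>Here \<open>J\<close> and \<open>K\<close> are the join and the meet in the lattice of cyclic flats of \<open>N1\<close>; they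
  are replaced by \<open>E\<close> and \<open>{}\<close> where \<open>lift\<close> does not apply.\<close>

lemma lift_bounds:
  assumes FG: "F \<in> proper_cyclic_flats N1" "G \<in> proper_cyclic_flats N1"
  obtains J j K l where "J = E \<and> j = k \<or> (\<exists>H\<in>proper_cyclic_flats N1. J = lift H \<and> j = lift_rank H)"
    "K = {} \<and> l = 0 \<or> (\<exists>H\<in>proper_cyclic_flats N1. K = lift H \<and> l = lift_rank H)"
    "lift F \<union> lift G \<subseteq> J" "K \<subseteq> lift F \<inter> lift G"
    "j + l + card (lift F \<inter> lift G - K) \<le> lift_rank F + lift_rank G"
proof -
  obtain J K where JK: "R1.closed J" "R1.coloop_free J" "R1.closed K" "R1.coloop_free K"
      "F \<union> G \<subseteq> J" "K \<subseteq> F \<inter> G" "rank N1 J + rank N1 K + card (F \<inter> G - K) \<le> rank N1 F + rank N1 G"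
    using R1.cyclic_flat_bounds[of F G] pcf_D FG by metis
  have sub: "F \<subset> ground N1" "G \<subset> ground N1" using pcf_D(1) FG by auto
  have subJK: "J \<subseteq> ground N1" "K \<subseteq> ground N1" using JK by (auto simp: R1.closed_def)
  define J' where "J' = (if J = ground N1 then E else lift J)"
  define K' where "K' = (if K = {} then {} else lift K)"
  \<comment> \<open>No case distinction here: by \<open>card_U1\<close> the formula yields k at J =
    ground N1. At K = {} it would yield |U1| + |A2| instead of 0, so \<open>l\<close> needs
    one.\<close>
  define j where "j = lift_rank J"
  define l where "l = (if K = {} then 0 else lift_rank K)"
  have "J' = E \<and> j = k \<or> (\<exists>H\<in>proper_cyclic_flats N1. J' = lift H \<and> j = lift_rank H)"
  proof (cases "J = ground N1")
    case True
    then show ?thesis using card_U1 by (simp add: J'_def j_def lift_rank_def)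
  next
    case False
    then have "J \<in> proper_cyclic_flats N1" using JK pcf_D(2)[OF FG(1)] by (intro pcf_I) auto
    then show ?thesis using False by (auto simp: J'_def j_def)
  qed
  moreover have "K' = {} \<and> l = 0 \<or> (\<exists>H\<in>proper_cyclic_flats N1. K' = lift H \<and> l = lift_rank H)"
  proof (cases "K = {}")
    case False
    then have "K \<in> proper_cyclic_flats N1" using JK sub by (intro pcf_I) auto
    then show ?thesis using False by (auto simp: K'_def l_def)
  qed (simp add: K'_def l_def)
  moreover have "lift F \<union> lift G \<subseteq> J'"
  proof -
    have "lift F \<union> lift G \<subseteq> lift J" using JK by (auto simp: lift_def)
    then show ?thesis using lift_subset_E[of J] subJK by (auto simp: J'_def)
  qed
  moreover have "K' \<subseteq> lift F \<inter> lift G" using JK by (auto simp: K'_def lift_def)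
  moreover have "j + l + card (lift F \<inter> lift G - K') \<le> lift_rank F + lift_rank G"
  proof (cases "K = {}")
    case True
    \<comment> \<open>The |U1| + |A2| missing from the rank of the empty set reappears in the
      cardinality of the intersection.\<close>
    have "lift F \<inter> lift G = lift (F \<inter> G)" using sub disj A2 by (auto simp: lift_def)
    then have "card (lift F \<inter> lift G) = card (F \<inter> G) + card U1 + card A2"
      using card_lift[of "F \<inter> G"] sub by auto
    then show ?thesis using True JK(7) by (simp add: K'_def l_def j_def lift_rank_def)
  next
    case False
    have "lift F \<inter> lift G - lift K = F \<inter> G - K" using sub disj A2 by (auto simp: lift_def)
    then show ?thesis using False JK(7) by (simp add: K'_def l_def j_def lift_rank_def)
  qed
  ultimately show ?thesis by (rule that)
qed

text \<open>An inclusion would force U1 = {} and F \<subseteq> A1. With U1 empty the bound on k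
  makes A1 independent, yet F is dependent. So flats from different sides are incomparable and the
  strictness axiom has nothing to check for them.\<close>

lemma lift_not_subset_lift:
  assumes F: "F \<in> proper_cyclic_flats N1" and G: "G \<subseteq> ground N2"
  shows "\<not> lift F \<subseteq> G \<union> U2 \<union> A1"
proof
  assume sub: "lift F \<subseteq> G \<union> U2 \<union> A1"
  have FE: "F \<subseteq> ground N1" using pcf_D(1)[OF F] by auto
  have "U1 \<subseteq> G \<union> U2 \<union> A1" using sub by (simp add: lift_def)
  then have "U1 = {}" using disj A1 G by blast
  moreover have "F \<subseteq> G \<union> U2 \<union> A1" using sub by (simp add: lift_def)
  then have FA: "F \<subseteq> A1" using FE disj G by blast
  moreover have "rank N2 A2 \<le> total_rank N2" using A2 by (auto intro: R2.r_mono)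
  ultimately have "card A1 \<le> rank N1 A1" using card_U1 k_ge by simp
  moreover have "rank N1 A1 \<le> rank N1 F + card (A1 - F)"
    using FA A1 by (intro R1.r_diff_le)
  moreover have "card (A1 - F) = card A1 - card F" "card F \<le> card A1"
    using FA finite_A finite_subset by (auto intro!: card_Diff_subset card_mono)
  ultimately show False using pcf_D(5)[OF F] by linarith
qed

text \<open>Nullity is monotone and F \<inter> A1 has at most the rank of F, so |F \<inter> A1| -
  rank F is at most the nullity of A1; likewise for G and A2. \<open>k_ge\<close> then closes the
  gap.\<close>

lemma cross_bound:
  assumes F: "F \<subseteq> ground N1" and G: "G \<subseteq> ground N2"
  shows "k + card (lift F \<inter> (G \<union> U2 \<union> A1)) \<le> lift_rank F + (rank N2 G + card U2 + card A1)"
proof -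
  have "lift F \<inter> (G \<union> U2 \<union> A1) = F \<inter> A1 \<union> G \<inter> A2"
    using F G A1 A2 disj by (auto simp: lift_def)
  then have "card (lift F \<inter> (G \<union> U2 \<union> A1)) \<le> card (F \<inter> A1) + card (G \<inter> A2)"
    by (simp add: card_Un_le)
  moreover have "rank N1 A1 + card (F \<inter> A1) \<le> rank N1 F + card A1"
  proof -
    have "rank N1 A1 \<le> rank N1 (F \<inter> A1) + card (A1 - F \<inter> A1)"
      using A1 by (intro R1.r_diff_le) auto
    moreover have "rank N1 (F \<inter> A1) \<le> rank N1 F" using F by (intro R1.r_mono) auto
    moreover have "card (A1 - F \<inter> A1) + card (F \<inter> A1) = card A1"
      using finite_A card_Diff_subset[of "F \<inter> A1" A1] card_mono[of A1 "F \<inter> A1"] by simp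
    ultimately show ?thesis by linarith
  qed
  moreover have "rank N2 A2 + card (G \<inter> A2) \<le> rank N2 G + card A2"
  proof -
    have "rank N2 A2 \<le> rank N2 (G \<inter> A2) + card (A2 - G \<inter> A2)"
      using A2 by (intro R2.r_diff_le) auto
    moreover have "rank N2 (G \<inter> A2) \<le> rank N2 G" using G by (intro R2.r_mono) auto
    moreover have "card (A2 - G \<inter> A2) + card (G \<inter> A2) = card A2"
      using finite_A card_Diff_subset[of "G \<inter> A2" A2] card_mono[of A2 "G \<inter> A2"] by simp
    ultimately show ?thesis by linarith
  qed
  ultimately show ?thesis using k_ge card_U1 card_U2 by (simp add: lift_rank_def)
qed

section \<open>Assembling the two sides into one family\<close>

lemma exists_is_Mk: "\<exists>M. is_Mk (int k) N1 A1 U1 N2 A2 U2 M"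
proof -
  interpret S: Mk_data N2 N1 A2 U2 A1 U1 k by (rule swap)
  have SE: "S.E = E" by (auto simp: E_def S.E_def)
  define \<F>1 where "\<F>1 = lift ` proper_cyclic_flats N1"
  define \<F>2 where "\<F>2 = S.lift ` proper_cyclic_flats N2"
  define \<Z> where "\<Z> = {{}, E} \<union> \<F>1 \<union> \<F>2"
  \<comment> \<open>A set is decoded by intersecting it with a ground set, as in
    \<open>lift_Int_ground\<close>. The tests do not interfere: lifted flats are neither {} nor E,
    and by \<open>not_sub\<close> none comes from both sides. Values outside \<Z> are
    arbitrary.\<close>
  define \<rho> where "\<rho> Z = (if Z = {} then 0 else if Z = E then k
    else if Z \<in> \<F>1 then lift_rank (Z \<inter> ground N1) else S.lift_rank (Z \<inter> ground N2))" for Z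
  have not_sub: "\<not> lift F \<subseteq> S.lift G" "\<not> S.lift G \<subseteq> lift F"
    if "F \<in> proper_cyclic_flats N1" "G \<in> proper_cyclic_flats N2" for F G
    using lift_not_subset_lift[of F G] S.lift_not_subset_lift[of G F] pcf_D(1) S.pcf_D(1) that
    by (auto simp: lift_def S.lift_def)
  have E_ne: "E \<noteq> {}" using k_less_card_E by auto
  have \<rho>_simps: "\<rho> {} = 0" "\<rho> E = k" using E_ne by (auto simp: \<rho>_def)
  have ne: "lift F \<noteq> {}" "lift F \<noteq> E" "lift F \<subseteq> E" if "F \<in> proper_cyclic_flats N1" for F
    using lift_rank_less_card[OF that] lift_corank[OF that] lift_rank_less_k[OF that]
      lift_subset_E pcf_D(1)[OF that] by auto
  have Sne: "S.lift F \<noteq> {}" "S.lift F \<noteq> E" "S.lift F \<subseteq> E" if "F \<in> proper_cyclic_flats N2" for F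
    using S.lift_rank_less_card[OF that] S.lift_corank[OF that] S.lift_rank_less_k[OF that]
      S.lift_subset_E S.pcf_D(1)[OF that] SE by auto
  have \<rho>1: "\<rho> (lift F) = lift_rank F" if "F \<in> proper_cyclic_flats N1" for F
    using ne[OF that] lift_Int_ground[of F] pcf_D(1)[OF that] that by (auto simp: \<rho>_def \<F>1_def)
  have \<rho>2: "\<rho> (S.lift G) = S.lift_rank G" if G: "G \<in> proper_cyclic_flats N2" for G
  proof -
    have "S.lift G \<noteq> lift F" if "F \<in> proper_cyclic_flats N1" for F
      using not_sub(1)[OF that G] by auto
    then have "S.lift G \<notin> \<F>1" by (auto simp: \<F>1_def)
    then show ?thesis
      using Sne[OF G] S.lift_Int_ground[of G] S.pcf_D(1)[OF G] by (auto simp: \<rho>_def)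
  qed
  have \<Z>_cases: "Z \<in> \<Z> \<longleftrightarrow> Z = {} \<or> Z = E \<or> (\<exists>F\<in>proper_cyclic_flats N1. Z = lift F)
      \<or> (\<exists>G\<in>proper_cyclic_flats N2. Z = S.lift G)" for Z
    by (auto simp: \<Z>_def \<F>1_def \<F>2_def)
  have \<Z>E: "\<Z> \<subseteq> Pow E"
  proof
    fix Z assume "Z \<in> \<Z>"
    then show "Z \<in> Pow E" using ne(3) Sne(3) unfolding \<Z>_cases by blast
  qed
  have strict: "\<rho> X < \<rho> Y \<and> \<rho> Y + card X < \<rho> X + card Y"
    if XY: "X \<in> \<Z>" "Y \<in> \<Z>" "X \<subset> Y" for X Y
  proof -
    have "X \<noteq> E" using XY \<Z>E by auto
    then have X: "X = {} \<or> (\<exists>F\<in>proper_cyclic_flats N1. X = lift F)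
        \<or> (\<exists>F\<in>proper_cyclic_flats N2. X = S.lift F)"
      using XY(1) unfolding \<Z>_cases by blast
    have "Y \<noteq> {}" using XY by auto
    then have Y: "Y = E \<or> (\<exists>F\<in>proper_cyclic_flats N1. Y = lift F)
        \<or> (\<exists>F\<in>proper_cyclic_flats N2. Y = S.lift F)"
      using XY(2) unfolding \<Z>_cases by blast
    from X Y show ?thesis
    proof (elim disjE bexE)
      assume "X = {}" "Y = E"
      then show ?thesis using k_pos k_less_card_E by (simp add: \<rho>_simps)
    next
      fix F assume "X = {}" "F \<in> proper_cyclic_flats N1" "Y = lift F"
      then show ?thesis
        using lift_rank_pos lift_rank_less_card by (simp add: \<rho>_simps \<rho>1)
    next
      fix F assume "X = {}" "F \<in> proper_cyclic_flats N2" "Y = S.lift F"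
      then show ?thesis
        using S.lift_rank_pos S.lift_rank_less_card by (simp add: \<rho>_simps \<rho>2)
    next
      fix F assume "F \<in> proper_cyclic_flats N1" "X = lift F" "Y = E"
      then show ?thesis
        using lift_rank_less_k lift_corank by (simp add: \<rho>_simps \<rho>1)
    next
      fix F assume "F \<in> proper_cyclic_flats N2" "X = S.lift F" "Y = E"
      then show ?thesis
        using S.lift_rank_less_k S.lift_corank SE by (simp add: \<rho>_simps \<rho>2)
    next
      fix F G assume "F \<in> proper_cyclic_flats N1" "X = lift F" "G \<in> proper_cyclic_flats N1" "Y = lift G"
      then show ?thesis using lift_strict XY(3) by (simp add: \<rho>1)
    next
      fix F G assume "F \<in> proper_cyclic_flats N2" "X = S.lift F" "G \<in> proper_cyclic_flats N2" "Y = S.lift G"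
      then show ?thesis using S.lift_strict XY(3) by (simp add: \<rho>2)
    next
      fix F G assume "F \<in> proper_cyclic_flats N1" "X = lift F" "G \<in> proper_cyclic_flats N2" "Y = S.lift G"
      then show ?thesis using not_sub(1)[of F G] XY(3) by blast
    next
      fix F G assume "G \<in> proper_cyclic_flats N2" "X = S.lift G" "F \<in> proper_cyclic_flats N1" "Y = lift F"
      then show ?thesis using not_sub(2)[of F G] XY(3) by blast
    qed
  qed
  have cross: "\<rho> E + \<rho> {} + card (lift F \<inter> S.lift G - {}) \<le> \<rho> (lift F) + \<rho> (S.lift G)"
    if "F \<in> proper_cyclic_flats N1" "G \<in> proper_cyclic_flats N2" for F G
  proof -
    have "F \<subseteq> ground N1" "G \<subseteq> ground N2" using pcf_D(1) S.pcf_D(1) that by auto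
    from cross_bound[OF this] show ?thesis
      unfolding \<rho>_simps \<rho>1[OF that(1)] \<rho>2[OF that(2)] by (simp add: S.lift_def S.lift_rank_def)
  qed
  have E_empty: "E \<in> \<Z>" "{} \<in> \<Z>" by (simp_all add: \<Z>_cases)
  have bounds: "\<exists>J\<in>\<Z>. \<exists>K\<in>\<Z>. X \<union> Y \<subseteq> J \<and> K \<subseteq> X \<inter> Y \<and> \<rho> J + \<rho> K + card (X \<inter> Y - K) \<le> \<rho> X + \<rho> Y"
    if XY: "X \<in> \<Z>" "Y \<in> \<Z>" for X Y
  \<comment> \<open>A comparable pair serves as its own bounds. This settles {} and E, so only
    lifted flats remain in the other case.\<close>
  proof (cases "X \<subseteq> Y \<or> Y \<subseteq> X")
    case True
    then show ?thesis
    proof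
      assume "X \<subseteq> Y"
      then have "X \<union> Y \<subseteq> Y \<and> X \<subseteq> X \<inter> Y \<and> \<rho> Y + \<rho> X + card (X \<inter> Y - X) \<le> \<rho> X + \<rho> Y"
        by (simp add: Int_absorb2)
      then show ?thesis using XY by blast
    next
      assume "Y \<subseteq> X"
      then have "X \<union> Y \<subseteq> X \<and> Y \<subseteq> X \<inter> Y \<and> \<rho> X + \<rho> Y + card (X \<inter> Y - Y) \<le> \<rho> X + \<rho> Y"
        by (simp add: Int_absorb1)
      then show ?thesis using XY by blast
    qed
  next
    case False
    have XYE: "X \<subseteq> E" "Y \<subseteq> E" using XY \<Z>E by auto
    have "(\<exists>F\<in>proper_cyclic_flats N1. X = lift F) \<or> (\<exists>F\<in>proper_cyclic_flats N2. X = S.lift F)"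
      using XY(1) XYE False unfolding \<Z>_cases by blast
    moreover have "(\<exists>F\<in>proper_cyclic_flats N1. Y = lift F) \<or> (\<exists>F\<in>proper_cyclic_flats N2. Y = S.lift F)"
      using XY(2) XYE False unfolding \<Z>_cases by blast
    ultimately show ?thesis
    proof (elim disjE bexE)
      fix F G assume F: "F \<in> proper_cyclic_flats N1" "X = lift F"
        and G: "G \<in> proper_cyclic_flats N1" "Y = lift G"
      obtain J j K l where JK:
        "J = E \<and> j = k \<or> (\<exists>H\<in>proper_cyclic_flats N1. J = lift H \<and> j = lift_rank H)"
        "K = {} \<and> l = 0 \<or> (\<exists>H\<in>proper_cyclic_flats N1. K = lift H \<and> l = lift_rank H)"
        "lift F \<union> lift G \<subseteq> J" "K \<subseteq> lift F \<inter> lift G"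
        "j + l + card (lift F \<inter> lift G - K) \<le> lift_rank F + lift_rank G"
        using lift_bounds[OF F(1) G(1)] by blast
      have J: "J \<in> \<Z>" "\<rho> J = j" using JK(1) \<rho>_simps \<rho>1 unfolding \<Z>_cases by auto
      have K: "K \<in> \<Z>" "\<rho> K = l" using JK(2) \<rho>_simps \<rho>1 unfolding \<Z>_cases by auto
      have "X \<union> Y \<subseteq> J \<and> K \<subseteq> X \<inter> Y \<and> \<rho> J + \<rho> K + card (X \<inter> Y - K) \<le> \<rho> X + \<rho> Y"
        unfolding F(2) G(2) \<rho>1[OF F(1)] \<rho>1[OF G(1)] J(2) K(2) using JK(3-5) by blast
      then show ?thesis using J(1) K(1) by blast
    next
      fix F G assume F: "F \<in> proper_cyclic_flats N2" "X = S.lift F"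
        and G: "G \<in> proper_cyclic_flats N2" "Y = S.lift G"
      obtain J j K l where JK:
        "J = S.E \<and> j = k \<or> (\<exists>H\<in>proper_cyclic_flats N2. J = S.lift H \<and> j = S.lift_rank H)"
        "K = {} \<and> l = 0 \<or> (\<exists>H\<in>proper_cyclic_flats N2. K = S.lift H \<and> l = S.lift_rank H)"
        "S.lift F \<union> S.lift G \<subseteq> J" "K \<subseteq> S.lift F \<inter> S.lift G"
        "j + l + card (S.lift F \<inter> S.lift G - K) \<le> S.lift_rank F + S.lift_rank G"
        using S.lift_bounds[OF F(1) G(1)] by blast
      have J: "J \<in> \<Z>" "\<rho> J = j" using JK(1) \<rho>_simps \<rho>2 SE unfolding \<Z>_cases by auto
      have K: "K \<in> \<Z>" "\<rho> K = l" using JK(2) \<rho>_simps \<rho>2 unfolding \<Z>_cases by auto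
      have "X \<union> Y \<subseteq> J \<and> K \<subseteq> X \<inter> Y \<and> \<rho> J + \<rho> K + card (X \<inter> Y - K) \<le> \<rho> X + \<rho> Y"
        unfolding F(2) G(2) \<rho>2[OF F(1)] \<rho>2[OF G(1)] J(2) K(2) using JK(3-5) by blast
      then show ?thesis using J(1) K(1) by blast
    next
      fix F G assume FG: "F \<in> proper_cyclic_flats N1" "X = lift F"
        "G \<in> proper_cyclic_flats N2" "Y = S.lift G"
      then have "\<rho> E + \<rho> {} + card (X \<inter> Y - {}) \<le> \<rho> X + \<rho> Y" using cross by blast
      then show ?thesis using E_empty XYE by blast
    next
      fix F G assume FG: "G \<in> proper_cyclic_flats N2" "X = S.lift G"
        "F \<in> proper_cyclic_flats N1" "Y = lift F"
      then have "\<rho> E + \<rho> {} + card (Y \<inter> X - {}) \<le> \<rho> Y + \<rho> X" using cross by blast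
      then have "\<rho> E + \<rho> {} + card (X \<inter> Y - {}) \<le> \<rho> X + \<rho> Y"
        by (simp only: Int_commute add.commute[of "\<rho> X"])
      then show ?thesis using E_empty XYE by blast
    qed
  qed
  have "\<exists>M. matroid M \<and> ground M = E \<and> (\<forall>Z. cyclic_flat M Z \<longleftrightarrow> Z \<in> \<Z>) \<and> (\<forall>Z\<in>\<Z>. rank M Z = \<rho> Z)"
    by (intro exists_matroid_with_cyclic_flats[where \<rho> = \<rho>, OF finite_E \<Z>E E_empty(2) \<rho>_simps(1)] strict bounds)
  then obtain M where M: "matroid M" "ground M = E" "\<forall>Z. cyclic_flat M Z \<longleftrightarrow> Z \<in> \<Z>"
      and rank_M: "\<forall>Z\<in>\<Z>. rank M Z = \<rho> Z"
    by (elim exE conjE)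
  have "{Z. cyclic_flat M Z} = {{}, ground M}
       \<union> {F \<union> U1 \<union> A2 | F. F \<in> proper_cyclic_flats N1}
       \<union> {F \<union> U2 \<union> A1 | F. F \<in> proper_cyclic_flats N2}"
  proof -
    have "{Z. cyclic_flat M Z} = \<Z>" using M(3) by simp
    then show ?thesis
      unfolding M(2) \<Z>_def \<F>1_def \<F>2_def
      by (simp only: Setcompr_eq_image lift_def[abs_def] S.lift_def[abs_def] mem_Collect_eq Collect_mem_eq)
  qed
  moreover have "rank M (F \<union> U1 \<union> A2) = rank N1 F + card U1 + card A2"
    if F: "F \<in> proper_cyclic_flats N1" for F
  proof -
    have "lift F \<in> \<Z>" using F unfolding \<Z>_cases by blast
    then show ?thesis using rank_M \<rho>1[OF F] by (simp add: lift_def lift_rank_def)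
  qed
  moreover have "rank M (F \<union> U2 \<union> A1) = rank N2 F + card U2 + card A1"
    if F: "F \<in> proper_cyclic_flats N2" for F
  proof -
    have "S.lift F \<in> \<Z>" using F unfolding \<Z>_cases by blast
    then show ?thesis using rank_M \<rho>2[OF F] by (simp add: S.lift_def S.lift_rank_def)
  qed
  moreover have "rank M {} = 0" "int (total_rank M) = int k"
    using M(2) rank_M E_empty \<rho>_simps by simp_all
  ultimately have "is_Mk (int k) N1 A1 U1 N2 A2 U2 M"
    unfolding is_Mk_def using M(1) M(2)[unfolded E_def] by (intro conjI ballI)
  then show ?thesis by blast
qed

end

section \<open>Uniqueness and duality of $M_k$\<close>

lemma is_Mk_swap: "is_Mk k N1 A1 U1 N2 A2 U2 M \<Longrightarrow> is_Mk k N2 A2 U2 N1 A1 U1 M"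
  unfolding is_Mk_def by (auto simp: Un_ac)

lemma is_Mk_total_rank: "is_Mk k N1 A1 U1 N2 A2 U2 M \<Longrightarrow> int (total_rank M) = k"
  unfolding is_Mk_def by (elim conjE)

lemma is_Mk_unique:
  assumes M: "is_Mk k N1 A1 U1 N2 A2 U2 M" and M': "is_Mk k N1 A1 U1 N2 A2 U2 M'"
  shows "M = M'"
proof (rule matroid_eqI_cyclic_flats)
  show "matroid M" "matroid M'" and ground: "ground M = ground M'"
    using M M' by (simp_all add: is_Mk_def)
  define \<Z> where "\<Z> = {{}, ground M} \<union> {F \<union> U1 \<union> A2 | F. F \<in> proper_cyclic_flats N1}
    \<union> {F \<union> U2 \<union> A1 | F. F \<in> proper_cyclic_flats N2}"
  have "{Z. cyclic_flat M Z} = \<Z>"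
    using M unfolding is_Mk_def \<Z>_def by (elim conjE)
  moreover have "{Z. cyclic_flat M' Z} = \<Z>"
    using M' unfolding is_Mk_def \<Z>_def ground by (elim conjE)
  ultimately have cf: "cyclic_flat M Z \<longleftrightarrow> Z \<in> \<Z>" "cyclic_flat M' Z \<longleftrightarrow> Z \<in> \<Z>" for Z
    by auto
  then show "cyclic_flat M Z \<longleftrightarrow> cyclic_flat M' Z" for Z by blast
  have "int (total_rank M) = int (total_rank M')"
    using is_Mk_total_rank[OF M] is_Mk_total_rank[OF M'] by simp
  then have "total_rank M = rank M' (ground M)" using ground by simp
  moreover fix Z assume "cyclic_flat M Z"
  ultimately show "rank M Z = rank M' Z"
    unfolding cf \<Z>_def using M M' by (auto simp: is_Mk_def)
qed

text \<open>In the corank formula for M the complement contributes |U1| + |A2| and the total rank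
  subtracts k. Their difference is -r(M1), exactly the term that completes the corank formula for
  M1.\<close>

lemma is_Mk_dual_rank:
  assumes M1: "matroid M1" and M2: "matroid M2"
    and disj: "ground M1 \<inter> ground M2 = {}" "U1 \<inter> U2 = {}"
      "U1 \<inter> (ground M1 \<union> ground M2) = {}" "U2 \<inter> (ground M1 \<union> ground M2) = {}"
    and A2: "A2 \<subseteq> ground M2" and U2: "finite U2"
    and card_U1: "int (card U1) = k - int (total_rank M1) - int (card A2)"
    and M: "is_Mk k M1 A1 U1 M2 A2 U2 M"
    and F: "F \<in> proper_cyclic_flats (dual M1)"
  shows "rank (dual M) (F \<union> U2 \<union> (ground M2 - A2))
    = rank (dual M1) F + card U2 + card (ground M2 - A2)"
proof -
  let ?X = "F \<union> U2 \<union> (ground M2 - A2)"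
  obtain G where G: "G \<in> proper_cyclic_flats M1" "F = ground M1 - G"
    using F proper_cyclic_flats_dual[OF M1] by auto
  then have sub: "F \<subseteq> ground M1" "ground M1 - F = G"
    using cyclic_flat_subset_ground[of M1 G] by (auto simp: proper_cyclic_flats_def)
  have fin: "finite F" "finite (ground M2 - A2)"
    using sub(1) M1 M2 matroid_finite finite_subset by auto
  have ground: "ground M = ground M1 \<union> ground M2 \<union> U1 \<union> U2" and m: "matroid M"
    using M by (simp_all add: is_Mk_def)
  have "card ?X = card (F \<union> U2) + card (ground M2 - A2)"
    using sub(1) disj fin U2 by (intro card_Un_disjoint) auto
  also have "card (F \<union> U2) = card F + card U2"
    using sub(1) disj fin U2 by (intro card_Un_disjoint) auto
  finally have "card ?X = card F + card U2 + card (ground M2 - A2)" .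
  moreover have "ground M - ?X = G \<union> U1 \<union> A2"
    unfolding ground using sub disj A2 by auto
  then have "rank M (ground M - ?X) = rank M1 G + card U1 + card A2"
    using M G(1) by (simp add: is_Mk_def)
  moreover have "int (total_rank M) = k" using M by (rule is_Mk_total_rank)
  moreover have "?X \<subseteq> ground M" using sub(1) ground by auto
  then have "rank (dual M) ?X + total_rank M = card ?X + rank M (ground M - ?X)"
    by (rule rank_dual[OF m])
  moreover have "rank (dual M1) F + total_rank M1 = card F + rank M1 G"
    using rank_dual[OF M1 sub(1)] sub(2) by simp
  ultimately show ?thesis using card_U1 by linarith
qed

text \<open>The complement of F \<union> U1 \<union> A2 is (ground M1 - F) \<union> U2 \<union>
  (ground M2 - A2); this is why U1 and U2 trade places while each Mi keeps its own.\<close>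

lemma is_Mk_dual:
  assumes M1: "matroid M1" and M2: "matroid M2"
    and disj: "ground M1 \<inter> ground M2 = {}" "U1 \<inter> U2 = {}"
      "U1 \<inter> (ground M1 \<union> ground M2) = {}" "U2 \<inter> (ground M1 \<union> ground M2) = {}"
    and A: "A1 \<subseteq> ground M1" "A2 \<subseteq> ground M2" and U: "finite U1" "finite U2"
    and card_U1: "int (card U1) = k - int (total_rank M1) - int (card A2)"
    and card_U2: "int (card U2) = k - int (total_rank M2) - int (card A1)"
    and j: "j = int (card (ground M1)) + int (card (ground M2)) + int (card U1) + int (card U2) - k"
    and M: "is_Mk k M1 A1 U1 M2 A2 U2 M"
  shows "is_Mk j (dual M1) (ground M1 - A1) U2 (dual M2) (ground M2 - A2) U1 (dual M)"
  unfolding is_Mk_def ground_dual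
proof (intro conjI ballI)
  have m: "matroid M" and ground: "ground M = ground M1 \<union> ground M2 \<union> U1 \<union> U2"
    using M by (simp_all add: is_Mk_def)
  have k: "int (total_rank M) = k" using M by (rule is_Mk_total_rank)
  have cf: "{Z. cyclic_flat M Z} = {{}, ground M}
       \<union> {F \<union> U1 \<union> A2 | F. F \<in> proper_cyclic_flats M1}
       \<union> {F \<union> U2 \<union> A1 | F. F \<in> proper_cyclic_flats M2}"
    using M unfolding is_Mk_def by (elim conjE)
  show "matroid (dual M)" using m by (rule matroid_dual)
  show "ground M = ground M1 \<union> ground M2 \<union> U2 \<union> U1" using ground by auto
  interpret rank_function "ground (dual M)" "rank (dual M)"
    using matroid_dual[OF m] by (rule rank_function_rank)
  show "rank (dual M) {} = 0" by (rule r_empty)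
  have "ground M - (F \<union> U1 \<union> A2) = (ground M1 - F) \<union> U2 \<union> (ground M2 - A2)"
    if "F \<in> proper_cyclic_flats M1" for F
  proof -
    have "F \<subseteq> ground M1"
      using that cyclic_flat_subset_ground by (auto simp: proper_cyclic_flats_def)
    then show ?thesis unfolding ground using disj A by auto
  qed
  moreover have "ground M - (F \<union> U2 \<union> A1) = (ground M2 - F) \<union> U1 \<union> (ground M1 - A1)"
    if "F \<in> proper_cyclic_flats M2" for F
  proof -
    have "F \<subseteq> ground M2"
      using that cyclic_flat_subset_ground by (auto simp: proper_cyclic_flats_def)
    then show ?thesis unfolding ground using disj A by auto
  qed
  ultimately have "(\<lambda>F. ground M - F) ` {F. cyclic_flat M F} = {{}, ground M}
       \<union> (\<lambda>F. (ground M1 - F) \<union> U2 \<union> (ground M2 - A2)) ` proper_cyclic_flats M1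
       \<union> (\<lambda>F. (ground M2 - F) \<union> U1 \<union> (ground M1 - A1)) ` proper_cyclic_flats M2"
    unfolding cf image_Un by (simp add: Setcompr_eq_image image_image insert_commute)
  then show "{Z. cyclic_flat (dual M) Z} = {{}, ground M}
       \<union> {F \<union> U2 \<union> (ground M2 - A2) | F. F \<in> proper_cyclic_flats (dual M1)}
       \<union> {F \<union> U1 \<union> (ground M1 - A1) | F. F \<in> proper_cyclic_flats (dual M2)}"
    unfolding cyclic_flats_dual[OF m] proper_cyclic_flats_dual[OF M1] proper_cyclic_flats_dual[OF M2]
    by (simp add: Setcompr_eq_image image_image)
  have fin: "finite (ground M1)" "finite (ground M2)" using M1 M2 matroid_finite by auto
  have "card (ground M) = card (ground M1 \<union> ground M2 \<union> U1) + card U2"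
    unfolding ground using disj fin U by (intro card_Un_disjoint) auto
  also have "card (ground M1 \<union> ground M2 \<union> U1) = card (ground M1 \<union> ground M2) + card U1"
    using disj fin U by (intro card_Un_disjoint) auto
  also have "card (ground M1 \<union> ground M2) = card (ground M1) + card (ground M2)"
    using disj fin by (intro card_Un_disjoint) auto
  finally have "card (ground M) = card (ground M1) + card (ground M2) + card U1 + card U2" .
  moreover have "rank (dual M) (ground M) + total_rank M = card (ground M) + rank M {}"
    using rank_dual[OF m, of "ground M"] by simp
  moreover have "rank M {} = 0" using M by (simp add: is_Mk_def)
  ultimately show "int (rank (dual M) (ground M)) = j" using k j by linarith
  show "rank (dual M) (F \<union> U2 \<union> (ground M2 - A2)) = rank (dual M1) F + card U2 + card (ground M2 - A2)"
    if "F \<in> proper_cyclic_flats (dual M1)" for F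
    by (rule is_Mk_dual_rank[OF M1 M2 disj A(2) U(2) card_U1 M that])
  show "rank (dual M) (F \<union> U1 \<union> (ground M1 - A1)) = rank (dual M2) F + card U1 + card (ground M1 - A1)"
    if "F \<in> proper_cyclic_flats (dual M2)" for F
    using disj by (intro is_Mk_dual_rank[OF M2 M1 _ _ _ _ A(1) U(1) card_U2 is_Mk_swap[OF M] that]) auto
qed

section \<open>The numerical equivalence and the final statement\<close>

lemma total_rank_dual:
  assumes "matroid M"
  shows "total_rank (dual M) + total_rank M = card (ground M)"
  using rank_dual[OF assms, of "ground M"] rank_function.r_empty[OF rank_function_rank[OF assms]] by simp

text \<open>The cardinality cancels in the corank formula, leaving how far A is from spanning
  M.\<close>

lemma nullity_dual:
  assumes M: "matroid M" and A: "A \<subseteq> ground M"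
  shows "nullity (dual M) (ground M - A) = int (total_rank M) - int (rank M A)"
  using rank_dual[OF M, of "ground M - A"] A by (simp add: nullity_def double_diff)

theorem theorem3p2:
  fixes M1 M2 :: "'a matroid" and S1' S2' T1 T2 :: "'a set" and k j :: int
  assumes "matroid M1" and "matroid M2"
    and "0 < total_rank M1" and "0 < total_rank M2"
    and "ground M1 \<inter> ground M2 = {}"
    and "S1' \<subseteq> ground M1" and "S2' \<subseteq> ground M2"
    and "finite T1" and "finite T2"
    and "T1 \<inter> T2 = {}"
    and "T1 \<inter> (ground M1 \<union> ground M2) = {}"
    and "T2 \<inter> (ground M1 \<union> ground M2) = {}"
    and "int (card T1) = k - int (total_rank M1) - int (card S2')"
    and "int (card T2) = k - int (total_rank M2) - int (card S1')"
    and "j = int (card (ground M1)) + int (card (ground M2)) + int (card T1) + int (card T2) - k"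
  shows
    "(j \<ge> int (total_rank (dual M1)) + nullity (dual M1) (ground M1 - S1')
          + int (total_rank (dual M2)) + nullity (dual M2) (ground M2 - S2')
      \<longleftrightarrow>
      k \<ge> int (total_rank M1) + nullity M1 S1' + int (total_rank M2) + nullity M2 S2')
     \<and>
     (k \<ge> int (total_rank M1) + nullity M1 S1' + int (total_rank M2) + nullity M2 S2'
      \<longrightarrow>
      (0 < total_rank (dual M1) \<and> 0 < total_rank (dual M2)
         \<longrightarrow> (\<exists>!M. is_Mk k M1 S1' T1 M2 S2' T2 M))
      \<and>
      ((\<exists>M. is_Mk k M1 S1' T1 M2 S2' T2 M)
         \<longrightarrow> (\<exists>!M. is_Mk k M1 S1' T1 M2 S2' T2 M)
           \<and> (\<exists>!M. is_Mk j (dual M1) (ground M1 - S1') T2 (dual M2) (ground M2 - S2') T1 M)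
           \<and> dual (Mk k M1 S1' T1 M2 S2' T2)
               = Mk j (dual M1) (ground M1 - S1') T2 (dual M2) (ground M2 - S2') T1))"
proof -
  note M1 = assms(1) and M2 = assms(2)
  let ?is_Mk = "is_Mk k M1 S1' T1 M2 S2' T2"
  let ?is_Mj = "is_Mk j (dual M1) (ground M1 - S1') T2 (dual M2) (ground M2 - S2') T1"
  have "j \<ge> int (total_rank (dual M1)) + nullity (dual M1) (ground M1 - S1')
          + int (total_rank (dual M2)) + nullity (dual M2) (ground M2 - S2')
      \<longleftrightarrow> k \<ge> int (total_rank M1) + nullity M1 S1' + int (total_rank M2) + nullity M2 S2'"
    unfolding nullity_dual[OF M1 assms(6)] nullity_dual[OF M2 assms(7)]
    unfolding nullity_def
    using assms(13-15) total_rank_dual[OF M1] total_rank_dual[OF M2] by linarith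
  moreover have "\<exists>!M. ?is_Mk M"
    if k: "k \<ge> int (total_rank M1) + nullity M1 S1' + int (total_rank M2) + nullity M2 S2'"
      and "0 < total_rank (dual M1) \<and> 0 < total_rank (dual M2)"
  proof -
    \<comment> \<open>k is nonnegative as the sum of |T1|, r(M1) and |S2'|. Positive ranks of the
      duals become \<open>corank1\<close> and \<open>corank2\<close> through
      \<open>total_rank_dual\<close>.\<close>
    have "int (nat k) = k" using assms(13) by simp
    moreover from this have "Mk_data M1 M2 S1' T1 S2' T2 (nat k)"
      using assms that total_rank_dual[OF M1] total_rank_dual[OF M2]
      by unfold_locales (auto simp: nullity_def)
    ultimately have "\<exists>M. ?is_Mk M" using Mk_data.exists_is_Mk by metis
    then show ?thesis using is_Mk_unique by (intro ex_ex1I)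
  qed
  moreover have "(\<exists>!M. ?is_Mk M) \<and> (\<exists>!M. ?is_Mj M)
      \<and> dual (Mk k M1 S1' T1 M2 S2' T2)
        = Mk j (dual M1) (ground M1 - S1') T2 (dual M2) (ground M2 - S2') T1"
    if ex: "\<exists>M. ?is_Mk M"
  proof -
    obtain M where M: "?is_Mk M" using ex by blast
    then have D: "?is_Mj (dual M)"
      using assms by (intro is_Mk_dual) auto
    have "Mk k M1 S1' T1 M2 S2' T2 = M"
      unfolding Mk_def using M is_Mk_unique by (intro the_equality)
    moreover have "Mk j (dual M1) (ground M1 - S1') T2 (dual M2) (ground M2 - S2') T1 = dual M"
      unfolding Mk_def using D is_Mk_unique by (intro the_equality)
    ultimately show ?thesis using M D is_Mk_unique by (metis (no_types))
  qed
  ultimately show ?thesis by (intro conjI impI) blast+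
qed

end
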